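(* Let $z_{i,j}$ ($i=1,\dots,m$, $j=1,\dots,n$) be i.i.d. samples in $\mathcal Z$, let $f_i(w)=\frac1n\sum_{j=1}^n\phi(w,z_{i,j})+\frac\lambda2\|w\|_2^2$ and $f=\frac1m\sum_{i=1}^mf_i$ on $\mathbb R^d$ with $\lambda>0$, where $\phi(\cdot,z)$ is convex for every $z\in\mathcal Z$. Assume there are finite constants $(V_0,G,L,M)$ such that for any $z\in\mathcal Z$: (i) $\phi(w,z)\ge0$ for all $w\in\mathbb R^d$ and $\phi(0,z)\le V_0$; (ii) $\|\phi'(w,z)\|_2\le G$ for any $\|w\|_2\le\sqrt{2V_0/\lambda}$; (iii) $\|\phi''(w,z)\|_2\le L-\lambda$ for any $w\in\mathbb R^d$; (iv) $\|\phi''(u,z)-\phi''(w,z)\|_2\le M\|u-w\|_2$ for any $u,w\in\mathbb R^d$. Then for any $\delta\in(0,1)$, any $r>0$ and any $i\in\{1,\dots,m\}$, with probability at least $1-\delta$, $$\sup_{\|w\|_2\le r}\|f_i''(w)-f''(w)\|_2\le\mu_{r,\delta},$$ where $$\mu_{r,\delta}=\min\left\{L,\ \sqrt{\frac{32L^2d}{n}}\cdot\sqrt{\log\Bigl(1+\frac{rM\sqrt{2n}}{L}\Bigr)+\frac{\log(md/\delta)}{d}}\right\}.$$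
   Context: Primes on $\phi$ denote derivatives with respect to $w$; matrix norms are spectral norms. *)

theory Defs
  imports "HOL-Probability.Probability"
begin

definition gradient :: "(real ^ 'd \<Rightarrow> real) \<Rightarrow> real ^ 'd \<Rightarrow> real ^ 'd" where
  "gradient g w = (\<chi> k. frechet_derivative g (at w) (axis k 1))"

definition hessian :: "(real ^ 'd \<Rightarrow> real) \<Rightarrow> real ^ 'd \<Rightarrow> real ^ 'd ^ 'd" where
  "hessian g w = jacobian (gradient g) (at w)"

(* gradient and hessian are total functions; they carry their meaning only
   for functions satisfying this predicate. *)
definition twice_differentiable :: "(real ^ 'd \<Rightarrow> real) \<Rightarrow> bool" where
  "twice_differentiable g \<longleftrightarrow>
     (\<forall>w. g differentiable (at w)) \<and> (\<forall>w. gradient g differentiable (at w))"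

(* The built-in norm on real ^ 'd ^ 'd is the Frobenius norm; the spectral norm
   is the operator norm induced by the Euclidean norm. *)
definition spectral_norm :: "real ^ 'd ^ 'd \<Rightarrow> real" where
  "spectral_norm A = onorm (\<lambda>x. A *v x)"

definition local_loss ::
  "(real ^ 'd \<Rightarrow> 'z \<Rightarrow> real) \<Rightarrow> real \<Rightarrow> nat \<Rightarrow> (nat \<Rightarrow> 'z) \<Rightarrow> real ^ 'd \<Rightarrow> real" where
  "local_loss \<phi> lam n zs w =
     (1 / real n) * (\<Sum>j = 1..n. \<phi> w (zs j)) + (lam / 2) * (norm w)\<^sup>2"

definition global_loss ::
  "(real ^ 'd \<Rightarrow> 'z \<Rightarrow> real) \<Rightarrow> real \<Rightarrow> nat \<Rightarrow> nat \<Rightarrow> (nat \<Rightarrow> nat \<Rightarrow> 'z) \<Rightarrow> real ^ 'd \<Rightarrow> real" where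
  "global_loss \<phi> lam m n zs w =
     (1 / real m) * (\<Sum>i = 1..m. local_loss \<phi> lam n (zs i) w)"

(* The samples Z i j, defined on the probability space P, are independent with
   common law D; the sample space is space D with the sigma-algebra of D. *)
definition iid_samples ::
  "'a measure \<Rightarrow> 'z measure \<Rightarrow> nat \<Rightarrow> nat \<Rightarrow> (nat \<Rightarrow> nat \<Rightarrow> 'a \<Rightarrow> 'z) \<Rightarrow> bool" where
  "iid_samples P D m n Z \<longleftrightarrow>
     prob_space P \<and>
     prob_space.indep_vars P (\<lambda>_. D) (\<lambda>(i, j). Z i j) ({1..m} \<times> {1..n}) \<and>
     (\<forall>i\<in>{1..m}. \<forall>j\<in>{1..n}. distr P D (Z i j) = D)"

end

theory Submission
  imports Defs
begin

text \<open>
The difference of the Hessians of \<open>f\<^sub>i\<close> and \<open>f\<close> is the average over \<open>k\<close> of the differences of the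
Hessians of \<open>f\<^sub>i\<close> and \<open>f\<^sub>k\<close>, and each of these is \<open>1/n\<close> times a sum \<open>X\<close> of \<open>n\<close> symmetric matrices
\<open>A\<^sub>j\<close> of spectral norm at most \<open>L\<close> (convexity makes the Hessians positive semidefinite, which saves a
factor 2). Exchanging the samples \<open>z\<^sub>i\<^sub>j\<close> and \<open>z\<^sub>k\<^sub>j\<close> preserves the distribution and flips the sign of
\<open>A\<^sub>j\<close> only. This symmetry gives the recursion
\<open>E tr X^(2p+2) \<le> (2p+1) n L\<^sup>2 E tr X^(2p)\<close>, hence the Gaussian tail
\<open>P(spectral norm of X > s) \<le> 2 d exp (- s\<^sup>2 / (2 n L\<^sup>2))\<close>. A union bound over \<open>k\<close> and over a net of
the ball of radius \<open>r\<close>, together with the Lipschitz continuity of the Hessians, gives the uniform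
bound; the case \<open>m = 1\<close> is trivial, and for \<open>m \<ge> 2\<close> the constant 32 absorbs the factor 2 of the
tail bound and the discretization error.
\<close>

section \<open>Trace inequalities for powers of symmetric matrices\<close>

text \<open>On \<open>real^'n^'n\<close> the operation \<open>\<bullet>\<close> is the Frobenius
  inner product, a trace of a product. Traces are kept in this form, and moving a factor to the
  other side takes the place of the cyclicity of the trace.\<close>

lemma inner_matrix_mult_left:
  fixes A B C :: "real^'n^'n"
  shows "(A ** B) \<bullet> C = B \<bullet> (transpose A ** C)"
proof -
  have "(A ** B) \<bullet> C = (\<Sum>i\<in>UNIV. \<Sum>j\<in>UNIV. \<Sum>k\<in>UNIV. A $ i $ k * B $ k $ j * C $ i $ j)"
    by (simp add: inner_vec_def matrix_matrix_mult_def sum_distrib_right)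
  also have "\<dots> = (\<Sum>i\<in>UNIV. \<Sum>k\<in>UNIV. \<Sum>j\<in>UNIV. A $ i $ k * B $ k $ j * C $ i $ j)"
    by (intro sum.cong refl sum.swap)
  also have "\<dots> = (\<Sum>k\<in>UNIV. \<Sum>i\<in>UNIV. \<Sum>j\<in>UNIV. A $ i $ k * B $ k $ j * C $ i $ j)"
    by (rule sum.swap)
  also have "\<dots> = (\<Sum>k\<in>UNIV. \<Sum>j\<in>UNIV. \<Sum>i\<in>UNIV. A $ i $ k * B $ k $ j * C $ i $ j)"
    by (intro sum.cong refl sum.swap)
  also have "\<dots> = B \<bullet> (transpose A ** C)"
    by (simp add: inner_vec_def matrix_matrix_mult_def transpose_def sum_distrib_left mult_ac)
  finally show ?thesis .
qed

lemma inner_transpose_transpose: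
  fixes A B :: "real^'n^'n"
  shows "transpose A \<bullet> transpose B = A \<bullet> B"
  unfolding inner_vec_def transpose_def by (simp add: inner_vec_def) (rule sum.swap)

lemma norm_transpose: "norm (transpose A) = norm (A :: real^'n^'n)"
  by (simp add: norm_eq_sqrt_inner inner_transpose_transpose)

lemma inner_matrix_mult_right:
  fixes A B C :: "real^'n^'n"
  shows "(A ** B) \<bullet> C = A \<bullet> (C ** transpose B)"
proof -
  have "(A ** B) \<bullet> C = (transpose B ** transpose A) \<bullet> transpose C"
    by (metis inner_transpose_transpose matrix_transpose_mul)
  also have "\<dots> = transpose A \<bullet> transpose (C ** transpose B)"
    by (simp add: inner_matrix_mult_left matrix_transpose_mul)
  finally show ?thesis by (simp only: inner_transpose_transpose)
qed

lemma norm_matrix_sq_columns: "(norm (B :: real^'n^'n))\<^sup>2 = (\<Sum>j\<in>UNIV. (norm (column j B))\<^sup>2)"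
  unfolding power2_norm_eq_inner inner_vec_def column_def
  by (simp add: inner_vec_def) (rule sum.swap)

text \<open>Left multiplication acts on each column separately, and squared Frobenius norms add over
  columns. Using the operator bound of \<open>A\<close> instead of its Frobenius norm keeps the
  dimension out of the variance.\<close>

lemma norm_matrix_mult_le:
  fixes A B :: "real^'n^'n"
  assumes "\<And>x. norm (A *v x) \<le> c * norm x" "0 \<le> c"
  shows "norm (A ** B) \<le> c * norm B"
proof (rule power2_le_imp_le)
  have col: "column j (A ** B) = A *v column j B" for j
    by (simp add: vec_eq_iff column_def matrix_matrix_mult_def matrix_vector_mult_def)
  have "(norm (A ** B))\<^sup>2 = (\<Sum>j\<in>UNIV. (norm (A *v column j B))\<^sup>2)"
    by (simp add: norm_matrix_sq_columns col)
  also have "\<dots> \<le> (\<Sum>j\<in>UNIV. (c * norm (column j B))\<^sup>2)"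
    by (intro sum_mono power_mono assms) simp
  also have "\<dots> = (c * norm B)\<^sup>2"
    by (simp add: power_mult_distrib norm_matrix_sq_columns sum_distrib_left)
  finally show "(norm (A ** B))\<^sup>2 \<le> (c * norm B)\<^sup>2" .
  show "0 \<le> c * norm B" using assms by simp
qed

lemma norm_matrix_vector_le: "norm (A *v x) \<le> norm (A :: real^'n^'n) * norm x"
proof (rule power2_le_imp_le)
  have "(norm (A *v x))\<^sup>2 = (\<Sum>i\<in>UNIV. (A $ i \<bullet> x)\<^sup>2)"
    unfolding power2_norm_eq_inner inner_vec_def[of "A *v x"]
    by (simp add: inner_vec_def matrix_vector_mult_def power2_eq_square)
  also have "\<dots> \<le> (\<Sum>i\<in>UNIV. (A $ i \<bullet> A $ i) * (x \<bullet> x))"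
    by (intro sum_mono Cauchy_Schwarz_ineq)
  also have "\<dots> = (norm A * norm x)\<^sup>2"
    unfolding power_mult_distrib power2_norm_eq_inner inner_vec_def[of A A]
    by (simp add: sum_distrib_right)
  finally show "(norm (A *v x))\<^sup>2 \<le> (norm A * norm x)\<^sup>2" .
qed simp

lemma inner_matrix_vector_transpose:
  fixes A :: "real^'n^'n"
  shows "(A *v x) \<bullet> y = x \<bullet> (transpose A *v y)"
  by (metis dot_lmul_matrix inner_commute matrix_vector_mul_linear
      transpose_matrix_vector transpose_transpose)

section \<open>Powers of matrices and noncommutative telescoping\<close>

primrec matpow :: "real^'n^'n \<Rightarrow> nat \<Rightarrow> real^'n^'n" where
  "matpow A 0 = mat 1"
| "matpow A (Suc k) = A ** matpow A k"

lemma matpow_add: "matpow A (k + l) = matpow A k ** matpow A l"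
  by (induction k) (auto simp: matrix_mul_assoc)

lemma matpow_Suc_right: "matpow A (Suc k) = matpow A k ** A"
  using matpow_add[of A k 1] by simp

lemma transpose_matpow: "transpose A = A \<Longrightarrow> transpose (matpow A k) = matpow A k"
proof (induction k)
  case (Suc k)
  then show ?case by (metis matpow.simps(2) matpow_Suc_right matrix_transpose_mul)
qed (simp add: transpose_mat)

lemma matrix_diff_ldistrib: "A ** (B - C) = A ** B - A ** (C :: real^'n^'n)"
  by (simp add: matrix_matrix_mult_def vec_eq_iff sum_subtractf algebra_simps)

lemma matrix_diff_rdistrib: "(B - C) ** A = B ** A - C ** (A :: real^'n^'n)"
  by (simp add: matrix_matrix_mult_def vec_eq_iff sum_subtractf algebra_simps)

lemma matrix_sum_ldistrib: "A ** (\<Sum>i\<in>S. F i) = (\<Sum>i\<in>S. A ** (F i :: real^'n^'n))"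
  by (induction S rule: infinite_finite_induct)
    (auto simp: matrix_add_ldistrib)

text \<open>The factors need not commute, so powers of \<open>X\<close> stay on the left and powers
  of \<open>Y\<close> on the right. Peeling off the leftmost factor gives the induction
  step.\<close>

lemma matpow_Suc_diff:
  fixes X Y :: "real^'n^'n"
  shows "matpow X (Suc n) - matpow Y (Suc n) =
    (\<Sum>q\<le>n. matpow X q ** (X - Y) ** matpow Y (n - q))"
proof (induction n)
  case (Suc n)
  have "matpow X (Suc (Suc n)) - matpow Y (Suc (Suc n)) =
     (X - Y) ** matpow Y (Suc n) + X ** (matpow X (Suc n) - matpow Y (Suc n))"
    by (simp add: matrix_diff_ldistrib matrix_diff_rdistrib)
  also have "X ** (matpow X (Suc n) - matpow Y (Suc n)) =
     (\<Sum>q\<le>n. matpow X (Suc q) ** (X - Y) ** matpow Y (n - q))"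
    unfolding Suc.IH matrix_sum_ldistrib by (simp add: matrix_mul_assoc)
  finally show ?case
    by (simp add: sum.atMost_Suc_shift del: sum.atMost_Suc)
qed simp

text \<open>Increments of a convex sequence grow, so \<open>b k + b (r - k)\<close> is at most the
  sum of the two end values. Pairing all terms in this way gives a discrete trapezoid bound.\<close>

lemma convex_sequence_sum_le:
  fixes b :: "nat \<Rightarrow> real"
  assumes conv: "\<And>k. Suc k < r \<Longrightarrow> 2 * b (Suc k) \<le> b k + b (Suc (Suc k))"
  shows "(\<Sum>k\<le>r. b k) \<le> (real r + 1) / 2 * (b 0 + b r)"
proof -
  define d where "d k = b (Suc k) - b k" for k
  have dmono: "i + l < r \<Longrightarrow> d i \<le> d (i + l)" for i l
  proof (induction l)
    case (Suc l)
    then show ?case using conv[of "i + l"] by (simp add: d_def)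
  qed simp
  have tel: "(\<Sum>i<k. d (s + i)) = b (s + k) - b s" for s k
    by (induction k) (auto simp: d_def)
  have pair: "b k + b (r - k) \<le> b 0 + b r" if "k \<le> r" for k
  proof -
    \<comment> \<open>The first \<open>k\<close> increments are dominated term by term by the last
      \<open>k\<close>.\<close>
    have "(\<Sum>i<k. d (0 + i)) \<le> (\<Sum>i<k. d (r - k + i))"
    proof (rule sum_mono)
      fix i assume "i \<in> {..<k}"
      then show "d (0 + i) \<le> d (r - k + i)" using that dmono[of i "r - k"] by (simp add: add.commute)
    qed
    then show ?thesis using that unfolding tel by simp
  qed
  have "(\<Sum>k\<le>r. b k) = (\<Sum>k\<le>r. b (r - k))"
    by (rule sum.reindex_bij_witness[of _ "\<lambda>k. r - k" "\<lambda>k. r - k"]) auto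
  then have "2 * (\<Sum>k\<le>r. b k) = (\<Sum>k\<le>r. b k + b (r - k))"
    by (simp add: sum.distrib)
  also have "\<dots> \<le> (\<Sum>k\<le>r. b 0 + b r)"
    by (intro sum_mono pair) simp
  finally show ?thesis by (simp add: field_simps)
qed

lemma sum_atMost_even_odd:
  fixes a :: "nat \<Rightarrow> real"
  shows "(\<Sum>q\<le>2 * r. a q) = (\<Sum>k\<le>r. a (2 * k)) + (\<Sum>k<r. a (2 * k + 1))"
  by (induction r) auto

lemma inner_le_half_sq: "x \<bullet> y \<le> ((norm x)\<^sup>2 + (norm y)\<^sup>2) / 2"
proof -
  have "0 \<le> (norm (x - y))\<^sup>2" by simp
  then show ?thesis by (simp add: power2_norm_eq_inner inner_diff inner_commute)
qed

text \<open>The summands with even \<open>q\<close> form a convex sequence and each odd one is at most the mean of its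
  neighbours, so the two extreme summands control the sum.\<close>

lemma trace_power_difference_le:
  fixes A X Y :: "real^'n^'n"
  assumes "transpose X = X" "transpose Y = Y"
  shows "(\<Sum>q\<le>2 * r. A \<bullet> (matpow X q ** A ** matpow Y (2 * r - q)))
    \<le> (2 * real r + 1) / 2 * ((norm (A ** matpow Y r))\<^sup>2 + (norm (matpow X r ** A))\<^sup>2)"
proof -
  define a where "a q = A \<bullet> (matpow X q ** A ** matpow Y (2 * r - q))" for q
  define B where "B k l = matpow X k ** A ** matpow Y l" for k l
  \<comment> \<open>Symmetry of \<open>X\<close> and \<open>Y\<close> lets any share of the
    exponents move to the other side, so one trace can be read as several different inner
    products.\<close>
  have B: "A \<bullet> (matpow X (k + k') ** A ** matpow Y (l + l')) = B k l \<bullet> B k' l'" for k k' l l'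
  proof -
    have "B k l \<bullet> B k' l' = (matpow X k ** A) \<bullet> (B k' l' ** matpow Y l)"
      by (simp only: B_def inner_matrix_mult_right transpose_matpow assms)
    also have "\<dots> = A \<bullet> (matpow X k ** (B k' l' ** matpow Y l))"
      by (simp only: inner_matrix_mult_left transpose_matpow assms)
    also have "\<dots> = A \<bullet> (matpow X (k + k') ** A ** matpow Y (l' + l))"
      by (simp only: B_def matpow_add matrix_mul_assoc)
    finally show ?thesis by (simp add: add.commute)
  qed
  have even: "a (2 * k) = (norm (B k (r - k)))\<^sup>2" if "k \<le> r" for k
  proof -
    have "2 * k = k + k" "2 * r - (k + k) = (r - k) + (r - k)" using that by auto
    then show ?thesis unfolding a_def power2_norm_eq_inner B[symmetric] by metis
  qed
  \<comment> \<open>The exponents are now split unevenly, into the two factors that belong to the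
    neighbouring even summands.\<close>
  have conv: "2 * a (2 * Suc k) \<le> a (2 * k) + a (2 * Suc (Suc k))" if "Suc k < r" for k
  proof -
    have "2 * Suc k = k + Suc (Suc k)" "2 * r - (k + Suc (Suc k)) = (r - k) + (r - Suc (Suc k))"
      using that by auto
    then have "a (2 * Suc k) = B k (r - k) \<bullet> B (Suc (Suc k)) (r - Suc (Suc k))"
      unfolding a_def B[symmetric] by metis
    also have "\<dots> \<le> (a (2 * k) + a (2 * Suc (Suc k))) / 2"
      using even[of k] even[of "Suc (Suc k)"] that by (metis Suc_leI Suc_lessD inner_le_half_sq less_or_eq_imp_le)
    finally show ?thesis by simp
  qed
  have odd: "a (2 * k + 1) \<le> (a (2 * k) + a (2 * Suc k)) / 2" if "k < r" for k
  proof -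
    have "2 * k + 1 = k + Suc k" "2 * r - (k + Suc k) = (r - k) + (r - Suc k)"
      using that by auto
    then have "a (2 * k + 1) = B k (r - k) \<bullet> B (Suc k) (r - Suc k)"
      unfolding a_def B[symmetric] by metis
    also have "\<dots> \<le> (a (2 * k) + a (2 * Suc k)) / 2"
      using even[of k] even[of "Suc k"] that by (metis Suc_leI inner_le_half_sq less_or_eq_imp_le)
    finally show ?thesis .
  qed
  have E: "(\<Sum>k\<le>r. a (2 * k)) \<le> (real r + 1) / 2 * (a 0 + a (2 * r))"
    using convex_sequence_sum_le[of r "\<lambda>k. a (2 * k)"] conv by simp
  have "(\<Sum>k<r. a (2 * k + 1)) \<le> (\<Sum>k<r. (a (2 * k) + a (2 * Suc k)) / 2)"
    by (intro sum_mono odd) simp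
  \<comment> \<open>Averaging neighbours counts every inner even term once and the two extreme ones
    by half.\<close>
  also have "\<dots> = (\<Sum>k\<le>r. a (2 * k)) - (a 0 + a (2 * r)) / 2"
    by (induction r) (auto simp: field_simps)
  finally have "(\<Sum>q\<le>2 * r. a q) \<le> 2 * (\<Sum>k\<le>r. a (2 * k)) - (a 0 + a (2 * r)) / 2"
    unfolding sum_atMost_even_odd by linarith
  also have "\<dots> \<le> (2 * real r + 1) / 2 * (a 0 + a (2 * r))"
    using E by (simp add: field_simps)
  also have "a 0 = (norm (A ** matpow Y r))\<^sup>2" using even[of 0] by (simp add: B_def)
  also have "a (2 * r) = (norm (matpow X r ** A))\<^sup>2" using even[of r] by (simp add: B_def)
  finally show ?thesis by (simp add: a_def)
qed

text \<open>This takes the place of a diagonalisation of \<open>X\<close>: the norms of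
  \<open>matpow X k *v x\<close> are log-convex in \<open>k\<close>, so no successive ratio falls
  below the first, and iteration gives the power.\<close>

lemma norm_mult_vec_power_le:
  fixes X :: "real^'n^'n"
  assumes sym: "transpose X = X" and x: "norm x = 1"
  shows "norm (X *v x) ^ p \<le> norm (matpow X p)"
proof -
  define s where "s k = norm (matpow X k *v x)" for k \<comment> \<open>a log-convex sequence\<close>
  have s0: "s 0 = 1" using x by (simp add: s_def)
  have snn: "0 \<le> s k" for k by (simp add: s_def)
  \<comment> \<open>One factor \<open>X\<close> is moved across the inner product before
    Cauchy-Schwarz is applied.\<close>
  have logc: "(s (Suc k))\<^sup>2 \<le> s k * s (Suc (Suc k))" for k
  proof -
    have "(s (Suc k))\<^sup>2 = (X *v (matpow X k *v x)) \<bullet> (matpow X (Suc k) *v x)"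
      by (simp add: s_def power2_norm_eq_inner matrix_vector_mul_assoc)
    also have "\<dots> = (matpow X k *v x) \<bullet> (matpow X (Suc (Suc k)) *v x)"
      by (subst inner_matrix_vector_transpose[of X])
        (simp only: sym inner_matrix_vector_transpose matrix_vector_mul_assoc[symmetric] matpow.simps(2)[of X "Suc k"])
    also have "\<dots> \<le> s k * s (Suc (Suc k))"
      unfolding s_def by (rule norm_cauchy_schwarz)
    finally show ?thesis .
  qed
  have ratio: "s 1 * s k \<le> s (Suc k)" for k
  proof (induction k)
    case (Suc k)
    show ?case
    proof (cases "s (Suc k) = 0")
      case False
      then have pos: "0 < s (Suc k)" using snn[of "Suc k"] by simp
      have "(s 1 * s (Suc k)) * s (Suc k) \<le> s 1 * (s k * s (Suc (Suc k)))"
        using mult_left_mono[OF logc[of k] snn[of 1]] by (simp add: power2_eq_square mult_ac)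
      also have "\<dots> \<le> s (Suc (Suc k)) * s (Suc k)"
        using mult_right_mono[OF Suc snn[of "Suc (Suc k)"]] by (simp add: mult_ac)
      finally show ?thesis using pos by (simp add: mult_le_cancel_right)
    qed (simp add: snn)
  qed (simp add: s0)
  have "s 1 ^ p \<le> s p"
  proof (induction p)
    case (Suc p)
    have "s 1 ^ Suc p \<le> s 1 * s p" using mult_left_mono[OF Suc snn[of 1]] by simp
    then show ?case using ratio[of p] by linarith
  qed (simp add: s0)
  also have "s p \<le> norm (matpow X p)"
    using norm_matrix_vector_le[of "matpow X p" x] x by (simp add: s_def)
  finally show ?thesis by (simp add: s_def)
qed

section \<open>A tail bound for sums of symmetrically distributed matrices\<close>

lemma norm_matrix_vector_le_spectral_norm: "norm (A *v x) \<le> spectral_norm A * norm x"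
  unfolding spectral_norm_def
  by (rule onorm) (simp add: linear_conv_bounded_linear[symmetric])

lemma spectral_norm_le: "(\<And>x. norm (A *v x) \<le> c * norm x) \<Longrightarrow> spectral_norm A \<le> c"
  unfolding spectral_norm_def by (rule onorm_le)

lemma spectral_norm_nonneg: "0 \<le> spectral_norm A"
  unfolding spectral_norm_def
  by (rule onorm_pos_le) (simp add: linear_conv_bounded_linear[symmetric])

lemma spectral_norm_triangle: "spectral_norm (A + B) \<le> spectral_norm A + spectral_norm B"
proof (rule spectral_norm_le)
  fix x
  have "norm ((A + B) *v x) \<le> norm (A *v x) + norm (B *v x)"
    by (simp add: matrix_vector_mult_add_rdistrib norm_triangle_ineq)
  also have "\<dots> \<le> spectral_norm A * norm x + spectral_norm B * norm x"
    by (intro add_mono norm_matrix_vector_le_spectral_norm)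
  finally show "norm ((A + B) *v x) \<le> (spectral_norm A + spectral_norm B) * norm x"
    by (simp add: algebra_simps)
qed

lemma spectral_norm_le_norm: "spectral_norm A \<le> norm A"
  by (intro spectral_norm_le norm_matrix_vector_le)

lemma spectral_norm_minus: "spectral_norm (- A) = spectral_norm A"
proof -
  have "(- A) *v x = - (A *v x)" for x
    by (simp add: matrix_vector_mult_def vec_eq_iff sum_negf)
  then show ?thesis by (simp add: spectral_norm_def onorm_neg)
qed

lemma spectral_norm_diff_le: "\<bar>spectral_norm A - spectral_norm B\<bar> \<le> spectral_norm (A - B)"
  using spectral_norm_triangle[of "A - B" B] spectral_norm_triangle[of "B - A" A]
    spectral_norm_minus[of "A - B"] by simp

text \<open>The spectral norm is 1-Lipschitz for the Frobenius norm, which is the metric of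
  \<open>real^'n^'n\<close>. Continuity makes the tail events measurable.\<close>

lemma continuous_on_spectral_norm: "continuous_on UNIV (spectral_norm :: real^'n^'n \<Rightarrow> real)"
proof (rule lipschitz_on_continuous_on)
  show "1-lipschitz_on UNIV (spectral_norm :: real^'n^'n \<Rightarrow> real)"
    using spectral_norm_diff_le spectral_norm_le_norm order_trans
    by (fastforce intro!: lipschitz_onI simp: dist_norm)
qed

lemma continuous_on_matrix_mult [continuous_intros]:
  fixes f g :: "'a::topological_space \<Rightarrow> real^'n^'n"
  assumes "continuous_on S f" "continuous_on S g"
  shows "continuous_on S (\<lambda>x. f x ** g x)"
  unfolding matrix_matrix_mult_def by (intro continuous_intros assms)

lemma continuous_on_matpow [continuous_intros]:
  fixes f :: "'a::topological_space \<Rightarrow> real^'n^'n"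
  assumes "continuous_on S f"
  shows "continuous_on S (\<lambda>x. matpow (f x) k)"
  by (induction k) (auto intro!: continuous_intros assms)

text \<open>A continuous image of a compact ball is bounded. The integrands of the moment recursion
  are continuous functions of bounded random matrices, so their integrability reduces to
  this.\<close>

lemma (in finite_measure) integrable_continuous_bounded:
  fixes U :: "'a \<Rightarrow> 'b::euclidean_space" and g :: "'b \<Rightarrow> real"
  assumes U: "U \<in> borel_measurable M" and b: "\<And>\<omega>. \<omega> \<in> space M \<Longrightarrow> norm (U \<omega>) \<le> B"
    and g: "continuous_on UNIV g"
  shows "integrable M (\<lambda>\<omega>. g (U \<omega>))"
proof -
  have "compact (g ` cball 0 B)"
    by (intro compact_continuous_image continuous_on_subset[OF g]) auto
  then obtain C where C: "\<And>y. y \<in> g ` cball 0 B \<Longrightarrow> norm y \<le> C"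
    using compact_imp_bounded bounded_iff by metis
  show ?thesis
  proof (rule integrable_const_bound[where B = C])
    show "AE \<omega> in M. norm (g (U \<omega>)) \<le> C"
      using b by (intro AE_I2 C) auto
    show "(\<lambda>\<omega>. g (U \<omega>)) \<in> borel_measurable M"
      by (rule borel_measurable_continuous_on[OF g U])
  qed
qed

lemma integral_invariant:
  fixes g :: "'a \<Rightarrow> real"
  assumes "T \<in> measurable M M" "distr M M T = M" "g \<in> borel_measurable M"
  shows "(\<integral>\<omega>. g (T \<omega>) \<partial>M) = (\<integral>\<omega>. g \<omega> \<partial>M)"
  using integral_distr[OF assms(1,3)] assms(2) by simp

lemma norm_mat_1: "(norm (mat 1 :: real^'n^'n))\<^sup>2 = real CARD('n)"
proof -
  have "(mat 1 :: real^'n^'n) \<bullet> mat 1 = (\<Sum>i\<in>(UNIV::'n set). \<Sum>j\<in>(UNIV::'n set). if i = j then 1 else 0)"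
    unfolding inner_vec_def mat_def by (intro sum.cong) (auto simp: inner_vec_def)
  also have "\<dots> = real CARD('n)" by simp
  finally show ?thesis by (simp add: power2_norm_eq_inner)
qed

lemma matrix_mult_scaleR_left: "(k *\<^sub>R A) ** B = k *\<^sub>R (A ** (B :: real^'n^'n))"
  by (simp add: matrix_matrix_mult_def vec_eq_iff sum_distrib_left mult_ac)

lemma matrix_mult_scaleR_right: "A ** (k *\<^sub>R B) = k *\<^sub>R (A ** (B :: real^'n^'n))"
  by (simp add: matrix_matrix_mult_def vec_eq_iff sum_distrib_left mult_ac)

section \<open>Moments and tails from sign symmetry\<close>

text \<open>The symmetry is expressed by measure preserving maps \<open>T j\<close> of the
  probability space itself, each reversing one summand and fixing the others, so no random signs
  have to be adjoined.\<close>

locale flip_symmetric_matrices = prob_space M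
  for M :: "'a measure" +
  fixes J :: "'j set" and A :: "'j \<Rightarrow> 'a \<Rightarrow> real^'n^'n" and T :: "'j \<Rightarrow> 'a \<Rightarrow> 'a" and c :: real
  assumes finite_J: "finite J"
    and measurable_A [measurable]: "\<And>j. j \<in> J \<Longrightarrow> A j \<in> borel_measurable M"
    and transpose_A: "\<And>j \<omega>. j \<in> J \<Longrightarrow> \<omega> \<in> space M \<Longrightarrow> transpose (A j \<omega>) = A j \<omega>"
    and A_bound: "\<And>j \<omega> x. j \<in> J \<Longrightarrow> \<omega> \<in> space M \<Longrightarrow> norm (A j \<omega> *v x) \<le> c * norm x"
    and c_nonneg: "0 \<le> c"
    and measurable_T [measurable]: "\<And>j. j \<in> J \<Longrightarrow> T j \<in> measurable M M"
    and distr_T: "\<And>j. j \<in> J \<Longrightarrow> distr M M (T j) = M"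
    and A_flip: "\<And>j \<omega>. j \<in> J \<Longrightarrow> \<omega> \<in> space M \<Longrightarrow> A j (T j \<omega>) = - A j \<omega>"
    and A_fix: "\<And>j k \<omega>. j \<in> J \<Longrightarrow> k \<in> J \<Longrightarrow> k \<noteq> j \<Longrightarrow> \<omega> \<in> space M \<Longrightarrow> A k (T j \<omega>) = A k \<omega>"
begin

definition X :: "'a \<Rightarrow> real^'n^'n" where "X \<omega> = (\<Sum>j\<in>J. A j \<omega>)"

lemma measurable_X [measurable]: "X \<in> borel_measurable M"
  unfolding X_def by measurable

lemma transpose_X: "\<omega> \<in> space M \<Longrightarrow> transpose (X \<omega>) = X \<omega>"
  using transpose_A by (simp add: X_def transpose_def vec_eq_iff)

text \<open>Obtained by applying the operator bound to the product with \<open>mat 1\<close>. The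
  dimension factor is harmless, since the estimate serves integrability only.\<close>

lemma norm_A: "j \<in> J \<Longrightarrow> \<omega> \<in> space M \<Longrightarrow> norm (A j \<omega>) \<le> c * norm (mat 1 :: real^'n^'n)"
  using norm_matrix_mult_le[of "A j \<omega>" c "mat 1"] A_bound c_nonneg by simp

lemma norm_X: "\<omega> \<in> space M \<Longrightarrow> norm (X \<omega>) \<le> card J * (c * norm (mat 1 :: real^'n^'n))"
  unfolding X_def using norm_A by (intro sum_norm_bound)

lemma integrable_continuous:
  assumes j: "j \<in> J" and g: "continuous_on UNIV (\<lambda>(a, x). g a x :: real)"
  shows "integrable M (\<lambda>\<omega>. g (A j \<omega>) (X \<omega>))"
proof -
  let ?K = "c * norm (mat 1 :: real^'n^'n)"
  have "integrable M (\<lambda>\<omega>. (\<lambda>(a, x). g a x) (A j \<omega>, X \<omega>))"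
  proof (rule integrable_continuous_bounded[OF _ _ g])
    show "(\<lambda>\<omega>. (A j \<omega>, X \<omega>)) \<in> borel_measurable M"
      using j by (intro borel_measurable_Pair) auto
    fix \<omega> assume "\<omega> \<in> space M"
    then show "norm (A j \<omega>, X \<omega>) \<le> ?K + card J * ?K"
      using norm_A[OF j] norm_X norm_Pair_le[of "A j \<omega>" "X \<omega>"] by (smt (verit))
  qed
  then show ?thesis by simp
qed

lemma integrable_continuous_X:
  assumes g: "continuous_on UNIV (g :: _ \<Rightarrow> real)"
  shows "integrable M (\<lambda>\<omega>. g (X \<omega>))"
  using norm_X by (intro integrable_continuous_bounded[OF _ _ g]) auto

lemma X_T: "j \<in> J \<Longrightarrow> \<omega> \<in> space M \<Longrightarrow> X (T j \<omega>) = X \<omega> - 2 *\<^sub>R A j \<omega>"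
  using A_fix by (simp add: X_def sum.remove[OF finite_J] A_flip scaleR_2)

text \<open>Flipping the sign of one summand turns \<open>E tr (A\<^sub>j X^(2r+1))\<close> into half the expected trace of
  \<open>A\<^sub>j (X^(2r+1) - Y^(2r+1))\<close> with \<open>X - Y = 2 A\<^sub>j\<close>, which telescopes.\<close>

lemma expectation_flip_le:
  assumes j: "j \<in> J"
  shows "expectation (\<lambda>\<omega>. A j \<omega> \<bullet> matpow (X \<omega>) (Suc (2 * r)))
    \<le> (2 * real r + 1) * c\<^sup>2 * expectation (\<lambda>\<omega>. (norm (matpow (X \<omega>) r))\<^sup>2)"
proof -
  let ?f = "\<lambda>\<omega>. A j \<omega> \<bullet> matpow (X \<omega>) (Suc (2 * r))"
  let ?Y = "\<lambda>\<omega>. X \<omega> - 2 *\<^sub>R A j \<omega>"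
  let ?fY = "\<lambda>\<omega>. A j \<omega> \<bullet> matpow (?Y \<omega>) (Suc (2 * r))"
  let ?h = "\<lambda>\<omega>. (norm (matpow (X \<omega>) r))\<^sup>2"
  let ?hY = "\<lambda>\<omega>. (norm (matpow (?Y \<omega>) r))\<^sup>2"
  have cont: "continuous_on UNIV (\<lambda>(a, x). a \<bullet> matpow x (Suc (2 * r)) :: real)"
    "continuous_on UNIV (\<lambda>(a, x). a \<bullet> matpow (x - 2 *\<^sub>R a) (Suc (2 * r)) :: real)"
    "continuous_on UNIV (\<lambda>(a, x). (norm (matpow (x - 2 *\<^sub>R a) r))\<^sup>2)"
    "continuous_on UNIV (\<lambda>x. (norm (matpow x r))\<^sup>2)"
    unfolding case_prod_beta by (intro continuous_intros)+
  note int = integrable_continuous[OF j cont(1)] integrable_continuous[OF j cont(2)]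
    integrable_continuous[OF j cont(3)] integrable_continuous_X[OF cont(4)]
  \<comment> \<open>Substituting \<open>T j\<close> reverses \<open>A j\<close> and turns
    \<open>X\<close> into \<open>?Y\<close>.\<close>
  have "expectation ?f = expectation (\<lambda>\<omega>. ?f (T j \<omega>))"
    using int(1) j by (intro integral_invariant[symmetric] distr_T) auto
  also have "\<dots> = expectation (\<lambda>\<omega>. - ?fY \<omega>)"
    by (intro Bochner_Integration.integral_cong refl) (simp only: A_flip[OF j] X_T[OF j] inner_minus_left)
  also have "\<dots> = - expectation ?fY" by simp
  finally have "2 * expectation ?f = expectation (\<lambda>\<omega>. ?f \<omega> - ?fY \<omega>)"
    using int by (simp only: Bochner_Integration.integral_diff)
  also have "\<dots> \<le> expectation (\<lambda>\<omega>. (2 * real r + 1) * c\<^sup>2 * (?hY \<omega> + ?h \<omega>))"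
  proof (rule integral_mono)
    fix \<omega> assume \<omega>: "\<omega> \<in> space M"
    let ?A = "A j \<omega>" and ?X = "X \<omega>" and ?y = "?Y \<omega>"
    have symA: "transpose ?A = ?A" and symX: "transpose ?X = ?X"
      using transpose_A[OF j \<omega>] transpose_X[OF \<omega>] by auto
    have symY: "transpose ?y = ?y"
      using symA symX by (simp add: transpose_def vec_eq_iff)
    have "?f \<omega> - ?fY \<omega> = ?A \<bullet> (\<Sum>q\<le>2 * r. matpow ?X q ** (2 *\<^sub>R ?A) ** matpow ?y (2 * r - q))"
      unfolding inner_diff_right[symmetric] matpow_Suc_diff by simp
    also have "\<dots> = 2 * (\<Sum>q\<le>2 * r. ?A \<bullet> (matpow ?X q ** ?A ** matpow ?y (2 * r - q)))"
      by (simp add: inner_sum_right sum_distrib_left matrix_mult_scaleR_left matrix_mult_scaleR_right)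
    also have "\<dots> \<le> (2 * real r + 1) * ((norm (?A ** matpow ?y r))\<^sup>2 + (norm (matpow ?X r ** ?A))\<^sup>2)"
      using trace_power_difference_le[OF symX symY, where A = ?A and r = r] by simp
    \<comment> \<open>Transposition puts \<open>?A\<close> on the left of both products, where its
      operator bound applies.\<close>
    also have "norm (matpow ?X r ** ?A) = norm (?A ** matpow ?X r)"
      by (metis matrix_transpose_mul norm_transpose symA symX transpose_matpow)
    also have "(2 * real r + 1) * ((norm (?A ** matpow ?y r))\<^sup>2 + (norm (?A ** matpow ?X r))\<^sup>2)
      \<le> (2 * real r + 1) * ((c * norm (matpow ?y r))\<^sup>2 + (c * norm (matpow ?X r))\<^sup>2)"
      by (intro mult_left_mono add_mono power_mono norm_matrix_mult_le A_bound j \<omega> c_nonneg) auto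
    finally show "?f \<omega> - ?fY \<omega> \<le> (2 * real r + 1) * c\<^sup>2 * (?hY \<omega> + ?h \<omega>)"
      by (simp add: power_mult_distrib algebra_simps)
  qed (intro Bochner_Integration.integrable_diff Bochner_Integration.integrable_add
      integrable_mult_right int)+
  also have "\<dots> = (2 * real r + 1) * c\<^sup>2 * (expectation ?hY + expectation ?h)"
    using int by simp
  \<comment> \<open>\<open>?Y\<close> is \<open>X\<close> after the flip, so both expectations
    agree, and their sum cancels the factor 2 on the left.\<close>
  also have "expectation ?hY = expectation (\<lambda>\<omega>. ?h (T j \<omega>))"
    by (intro Bochner_Integration.integral_cong refl) (simp only: X_T[OF j])
  also have "\<dots> = expectation ?h"
    using int(4) j by (intro integral_invariant distr_T) auto
  finally show ?thesis by simp
qed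

text \<open>The squared norm is the trace of \<open>X\<close> to the power 2r+2. Expanding a single
  factor \<open>X\<close> into its summands leaves terms that \<open>expectation_flip_le\<close>
  handles.\<close>

lemma moment_step:
  "expectation (\<lambda>\<omega>. (norm (matpow (X \<omega>) (Suc r)))\<^sup>2)
    \<le> (2 * real r + 1) * (card J * c\<^sup>2) * expectation (\<lambda>\<omega>. (norm (matpow (X \<omega>) r))\<^sup>2)"
proof -
  have "(norm (matpow (X \<omega>) (Suc r)))\<^sup>2 = (\<Sum>j\<in>J. A j \<omega> \<bullet> matpow (X \<omega>) (Suc (2 * r)))"
    if \<omega>: "\<omega> \<in> space M" for \<omega>
  proof -
    have "(norm (matpow (X \<omega>) (Suc r)))\<^sup>2 = X \<omega> \<bullet> (matpow (X \<omega>) (Suc r) ** matpow (X \<omega>) r)"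
      unfolding power2_norm_eq_inner
      by (simp only: matpow.simps(2)[of "X \<omega>" r] inner_matrix_mult_right transpose_matpow transpose_X \<omega>)
    also have "matpow (X \<omega>) (Suc r) ** matpow (X \<omega>) r = matpow (X \<omega>) (Suc (2 * r))"
      unfolding matpow_add[symmetric] by (simp add: mult_2)
    finally show ?thesis by (simp add: X_def inner_sum_left)
  qed
  then have "expectation (\<lambda>\<omega>. (norm (matpow (X \<omega>) (Suc r)))\<^sup>2)
      = expectation (\<lambda>\<omega>. \<Sum>j\<in>J. A j \<omega> \<bullet> matpow (X \<omega>) (Suc (2 * r)))"
    by (intro Bochner_Integration.integral_cong refl) blast
  also have "\<dots> = (\<Sum>j\<in>J. expectation (\<lambda>\<omega>. A j \<omega> \<bullet> matpow (X \<omega>) (Suc (2 * r))))"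
    by (intro Bochner_Integration.integral_sum integrable_continuous)
      (auto simp: case_prod_beta simp del: matpow.simps intro!: continuous_intros)
  also have "\<dots> \<le> (\<Sum>j\<in>J. (2 * real r + 1) * c\<^sup>2 * expectation (\<lambda>\<omega>. (norm (matpow (X \<omega>) r))\<^sup>2))"
    by (intro sum_mono expectation_flip_le)
  finally show ?thesis by (simp add: mult_ac)
qed

text \<open>Unwinding \<open>moment_step\<close> gives the moments of a centred Gaussian of variance
  \<open>card J * c\<^sup>2\<close>, times the dimension. Division by \<open>fact (2 * p)\<close>
  turns their double factorials into coefficients of an exponential series.\<close>

lemma moment_le:
  "expectation (\<lambda>\<omega>. (norm (matpow (X \<omega>) p))\<^sup>2) / fact (2 * p)
    \<le> real CARD('n) * ((card J * c\<^sup>2 / 2) ^ p / fact p)"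
proof (induction p)
  case 0
  then show ?case by (simp add: norm_mat_1 prob_space)
next
  case (Suc p)
  let ?E = "\<lambda>p. expectation (\<lambda>\<omega>. (norm (matpow (X \<omega>) p))\<^sup>2)"
  let ?v = "card J * c\<^sup>2"
  have "?E (Suc p) / fact (2 * Suc p) \<le> (2 * real p + 1) * ?v * ?E p / fact (2 * Suc p)"
    by (intro divide_right_mono moment_step) simp
  also have "\<dots> = ?v / (2 * real (Suc p)) * (?E p / fact (2 * p))"
    by (simp add: divide_simps)
  also have "\<dots> \<le> ?v / (2 * real (Suc p)) * (real CARD('n) * ((?v / 2) ^ p / fact p))"
    by (intro mult_left_mono Suc) simp
  also have "\<dots> = real CARD('n) * ((?v / 2) ^ Suc p / fact (Suc p))"
    by (simp add: divide_simps)
  finally show ?case .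
qed

text \<open>Markov's inequality for the trace of an even power: a spectral norm above
  \<open>s\<close> is witnessed by a unit vector, and \<open>norm_mult_vec_power_le\<close> carries
  this over to the power.\<close>

lemma power_mult_prob_le:
  assumes s: "0 \<le> s"
  shows "s ^ (2 * p) * prob {\<omega> \<in> space M. s < spectral_norm (X \<omega>)}
    \<le> expectation (\<lambda>\<omega>. (norm (matpow (X \<omega>) p))\<^sup>2)"
proof -
  let ?S = "{\<omega> \<in> space M. s < spectral_norm (X \<omega>)}"
  have "(\<lambda>\<omega>. spectral_norm (X \<omega>)) \<in> borel_measurable M"
    by (rule borel_measurable_continuous_on[OF continuous_on_spectral_norm measurable_X])
  then have S: "?S \<in> events" by measurable
  have "s ^ (2 * p) * prob ?S = expectation (\<lambda>\<omega>. s ^ (2 * p) * indicator ?S \<omega>)"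
    using S by simp
  also have "\<dots> \<le> expectation (\<lambda>\<omega>. (norm (matpow (X \<omega>) p))\<^sup>2)"
  proof (rule integral_mono)
    show "integrable M (\<lambda>\<omega>. s ^ (2 * p) * indicator ?S \<omega>)"
      using S by (intro integrable_mult_right) (simp add: emeasure_eq_measure)
    show "integrable M (\<lambda>\<omega>. (norm (matpow (X \<omega>) p))\<^sup>2)"
      by (intro integrable_continuous_X continuous_intros)
    fix \<omega> assume \<omega>: "\<omega> \<in> space M"
    show "s ^ (2 * p) * indicator ?S \<omega> \<le> (norm (matpow (X \<omega>) p))\<^sup>2"
    proof (cases "\<omega> \<in> ?S")
      case True
      then obtain x where x: "s * norm x < norm (X \<omega> *v x)"
        using spectral_norm_le[of "X \<omega>" s] by (force simp: not_less)
      then have x0: "x \<noteq> 0" by auto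
      define u where "u = (1 / norm x) *\<^sub>R x"
      have u: "norm u = 1" using x0 by (simp add: u_def)
      have "norm (X \<omega> *v u) = norm (X \<omega> *v x) / norm x"
        by (simp add: u_def matrix_scaleR_vector_ac scaleR_matrix_vector_assoc[symmetric])
      then have "s \<le> norm (X \<omega> *v u)" using x x0 by (simp add: le_divide_eq del: divide_eq_eq eq_divide_eq)
      then have "s ^ p \<le> norm (matpow (X \<omega>) p)"
        using norm_mult_vec_power_le[OF transpose_X[OF \<omega>] u, of p] power_mono[OF _ s]
        by (meson order_trans)
      then have "(s ^ p)\<^sup>2 \<le> (norm (matpow (X \<omega>) p))\<^sup>2" using s by (intro power_mono) auto
      then show ?thesis using True by (simp add: power_mult[symmetric] mult.commute)
    qed simp
  qed
  finally show ?thesis .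
qed

text \<open>A Chernoff bound with cosh in place of exp, because only even moments are available. The
  factor 2 is lost in bounding cosh below by half of exp.\<close>

theorem tail_bound:
  assumes s: "0 \<le> s" and v: "0 < card J * c\<^sup>2"
  shows "prob {\<omega> \<in> space M. s < spectral_norm (X \<omega>)}
    \<le> 2 * real CARD('n) * exp (- (s\<^sup>2 / (2 * (card J * c\<^sup>2))))"
proof -
  let ?p = "prob {\<omega> \<in> space M. s < spectral_norm (X \<omega>)}"
  define v where "v = card J * c\<^sup>2"
  \<comment> \<open>This value minimises the final exponent
    \<open>t\<^sup>2 * v / 2 - t * s\<close>.\<close>
  define t where "t = s / v"
  let ?d = "real CARD('n)"
  have vpos: "v > 0" using assms by (simp add: v_def)
  \<comment> \<open>Partial sums suffice, so no series is exchanged with an expectation.\<close>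
  have partial: "(\<Sum>k<N. (t * s) ^ (2 * k) / fact (2 * k)) * ?p \<le> ?d * exp (t\<^sup>2 * v / 2)" for N
  proof -
    have "(t * s) ^ (2 * k) / fact (2 * k) * ?p \<le> ?d * ((t\<^sup>2 * v / 2) ^ k / fact k)" for k
    proof -
      have "(t * s) ^ (2 * k) / fact (2 * k) * ?p = t ^ (2 * k) * ((s ^ (2 * k) * ?p) / fact (2 * k))"
        by (simp add: power_mult_distrib)
      also have "\<dots> \<le> t ^ (2 * k) * (?d * ((v / 2) ^ k / fact k))"
        unfolding v_def
        by (intro mult_left_mono order_trans[OF divide_right_mono[OF power_mult_prob_le[OF s]] moment_le])
           auto
      also have "\<dots> = ?d * ((t\<^sup>2 * v / 2) ^ k / fact k)"
        by (simp add: power_mult power_mult_distrib power_divide)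
      finally show ?thesis .
    qed
    then have "(\<Sum>k<N. (t * s) ^ (2 * k) / fact (2 * k) * ?p) \<le> (\<Sum>k<N. ?d * ((t\<^sup>2 * v / 2) ^ k / fact k))"
      by (intro sum_mono)
    also have "\<dots> = ?d * (\<Sum>k<N. (t\<^sup>2 * v / 2) ^ k / fact k)"
      by (simp add: sum_distrib_left)
    also have "(\<Sum>k<N. (t\<^sup>2 * v / 2) ^ k / fact k) \<le> exp (t\<^sup>2 * v / 2)"
    proof -
      have "(\<lambda>k. (t\<^sup>2 * v / 2) ^ k / fact k) sums exp (t\<^sup>2 * v / 2)"
        using exp_converges[of "t\<^sup>2 * v / 2"] by (simp only: divide_inverse_commute real_scaleR_def)
      then show ?thesis
        using vpos by (intro order_trans[OF sum_le_suminf]) (auto simp: sums_iff)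
    qed
    finally show ?thesis by (simp add: sum_distrib_right mult_left_mono)
  qed
  have "(\<lambda>k. if even k then (t * s) ^ k / fact k else 0) sums cosh (t * s)"
    using cosh_converges[of "t * s"] by (simp only: divide_inverse_commute real_scaleR_def)
  \<comment> \<open>The cosh series vanishes at odd indices and is reindexed by the even
    ones.\<close>
  then have "(\<lambda>k. (t * s) ^ (2 * k) / fact (2 * k)) sums cosh (t * s)"
    by (subst (asm) sums_mono_reindex[of "\<lambda>k. 2 * k", symmetric])
      (auto simp: strict_mono_def)
  then have "(\<lambda>N. (\<Sum>k<N. (t * s) ^ (2 * k) / fact (2 * k)) * ?p) \<longlonglongrightarrow> cosh (t * s) * ?p"
    unfolding sums_def by (intro tendsto_intros)
  then have "cosh (t * s) * ?p \<le> ?d * exp (t\<^sup>2 * v / 2)"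
    by (rule LIMSEQ_le_const2) (use partial in auto)
  moreover have "exp (t * s) / 2 * ?p \<le> cosh (t * s) * ?p"
    by (intro mult_right_mono) (auto simp: cosh_def)
  ultimately have "exp (t * s) * ?p \<le> 2 * ?d * exp (t\<^sup>2 * v / 2)" by linarith
  then have "?p \<le> 2 * ?d * (exp (t\<^sup>2 * v / 2) / exp (t * s))"
    by (simp add: field_simps)
  also have "exp (t\<^sup>2 * v / 2) / exp (t * s) = exp (- (s\<^sup>2 / (2 * v)))"
    using vpos by (simp add: exp_diff[symmetric] t_def field_simps power2_eq_square)
  finally show ?thesis by (simp add: v_def)
qed

end

section \<open>Hessians of convex functions\<close>

text \<open>A relational form with explicit witnesses: sums and multiples follow from the rules for
  \<open>has_derivative\<close>, and uniqueness leads back to \<open>gradient\<close> and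
  \<open>hessian\<close>.\<close>

definition has_gradient_hessian ::
  "(real^'n \<Rightarrow> real) \<Rightarrow> (real^'n \<Rightarrow> real^'n) \<Rightarrow> (real^'n \<Rightarrow> real^'n^'n) \<Rightarrow> bool" where
  "has_gradient_hessian g \<gamma> H \<longleftrightarrow>
     (\<forall>w. (g has_derivative (\<lambda>h. \<gamma> w \<bullet> h)) (at w)) \<and>
     (\<forall>w. (\<gamma> has_derivative (\<lambda>h. H w *v h)) (at w))"

lemma twice_differentiable_has_gradient_hessian:
  assumes "twice_differentiable g"
  shows "has_gradient_hessian g (gradient g) (hessian g)"
  unfolding has_gradient_hessian_def
proof (intro conjI allI)
  fix w
  have d: "(g has_derivative frechet_derivative g (at w)) (at w)"
    using assms by (simp add: twice_differentiable_def frechet_derivative_works[symmetric])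
  interpret linear "frechet_derivative g (at w)"
    using d by (rule has_derivative_linear)
  have "frechet_derivative g (at w) h = gradient g w \<bullet> h" for h
  proof -
    have "h = (\<Sum>k\<in>UNIV. (h $ k) *\<^sub>R axis k 1)"
      using basis_expansion[of h] by (simp add: scalar_mult_eq_scaleR)
    then have "frechet_derivative g (at w) h = (\<Sum>k\<in>UNIV. (h $ k) *\<^sub>R frechet_derivative g (at w) (axis k 1))"
      by (metis (no_types, lifting) scale sum sum.cong)
    then show ?thesis by (simp add: gradient_def inner_vec_def mult.commute)
  qed
  then have "frechet_derivative g (at w) = (\<lambda>h. gradient g w \<bullet> h)" by (rule ext)
  then show "(g has_derivative (\<lambda>h. gradient g w \<bullet> h)) (at w)"
    using d by (simp only:)
  show "(gradient g has_derivative (\<lambda>h. hessian g w *v h)) (at w)"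
    using assms by (simp add: twice_differentiable_def hessian_def jacobian_works[symmetric])
qed

lemma has_gradient_hessian_unique:
  assumes "has_gradient_hessian g \<gamma> H"
  shows "gradient g = \<gamma>" "hessian g = H"
proof -
  have fd: "frechet_derivative g (at w) = (\<lambda>h. \<gamma> w \<bullet> h)" for w
    using assms frechet_derivative_at by (metis has_gradient_hessian_def)
  show gr: "gradient g = \<gamma>"
    by (simp add: gradient_def fun_eq_iff fd vec_eq_iff inner_axis)
  have fd': "frechet_derivative \<gamma> (at w) = (\<lambda>h. H w *v h)" for w
    using assms frechet_derivative_at by (metis has_gradient_hessian_def)
  show "hessian g = H"
    by (rule ext) (simp only: hessian_def jacobian_def gr fd' matrix_of_matrix_vector_mul)
qed

lemma has_gradient_hessian_add:
  assumes "has_gradient_hessian f \<alpha> A" "has_gradient_hessian g \<beta> B"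
  shows "has_gradient_hessian (\<lambda>w. f w + g w) (\<lambda>w. \<alpha> w + \<beta> w) (\<lambda>w. A w + B w)"
  using assms unfolding has_gradient_hessian_def inner_add_left matrix_vector_mult_add_rdistrib
  by (intro conjI allI has_derivative_add) blast+

lemma has_gradient_hessian_scale:
  assumes "has_gradient_hessian f \<alpha> A"
  shows "has_gradient_hessian (\<lambda>w. k * f w) (\<lambda>w. k *\<^sub>R \<alpha> w) (\<lambda>w. k *\<^sub>R A w)"
  using assms
  unfolding has_gradient_hessian_def inner_scaleR_left scaleR_matrix_vector_assoc[symmetric]
  by (intro conjI allI has_derivative_mult_right has_derivative_scaleR_right) blast+

lemma has_gradient_hessian_zero: "has_gradient_hessian (\<lambda>w. 0) (\<lambda>w. 0) (\<lambda>w. 0)"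
  by (simp add: has_gradient_hessian_def)

lemma has_gradient_hessian_sum:
  assumes "\<And>i. i \<in> I \<Longrightarrow> has_gradient_hessian (f i) (\<alpha> i) (A i)"
  shows "has_gradient_hessian (\<lambda>w. \<Sum>i\<in>I. f i w) (\<lambda>w. \<Sum>i\<in>I. \<alpha> i w) (\<lambda>w. \<Sum>i\<in>I. A i w)"
  using assms
  by (induction I rule: infinite_finite_induct)
    (auto intro!: has_gradient_hessian_zero has_gradient_hessian_add)

lemma has_gradient_hessian_norm_sq:
  "has_gradient_hessian (\<lambda>w :: real^'n. k / 2 * (norm w)\<^sup>2) (\<lambda>w. k *\<^sub>R w) (\<lambda>w. k *\<^sub>R mat 1)"
  unfolding has_gradient_hessian_def power2_norm_eq_inner
  by (auto simp: scaleR_matrix_vector_assoc[symmetric] inner_commute intro!: derivative_eq_intros)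

text \<open>Only the Hessian is wanted in closed form, so the gradient is named by
  \<open>gradient\<close> itself, through uniqueness.\<close>

lemma has_gradient_hessian_local_loss:
  assumes "\<And>j. j \<in> {1..n} \<Longrightarrow> twice_differentiable (\<lambda>w. \<phi> w (zs j))"
  shows "has_gradient_hessian (local_loss \<phi> lam n zs)
    (gradient (local_loss \<phi> lam n zs))
    (\<lambda>w. (1 / real n) *\<^sub>R (\<Sum>j = 1..n. hessian (\<lambda>w. \<phi> w (zs j)) w) + lam *\<^sub>R mat 1)"
proof -
  have "has_gradient_hessian (local_loss \<phi> lam n zs)
    (\<lambda>w. (1 / real n) *\<^sub>R (\<Sum>j = 1..n. gradient (\<lambda>w. \<phi> w (zs j)) w) + lam *\<^sub>R w)
    (\<lambda>w. (1 / real n) *\<^sub>R (\<Sum>j = 1..n. hessian (\<lambda>w. \<phi> w (zs j)) w) + lam *\<^sub>R mat 1)"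
    unfolding local_loss_def[abs_def]
    by (intro has_gradient_hessian_add has_gradient_hessian_scale has_gradient_hessian_sum
        has_gradient_hessian_norm_sq twice_differentiable_has_gradient_hessian assms)
  from this[folded has_gradient_hessian_unique(1)[OF this]] show ?thesis .
qed

text \<open>The regulariser contributes \<open>lam *\<^sub>R mat 1\<close> to every local Hessian
  and cancels, which leaves differences between pairs of samples.\<close>

lemma hessian_local_minus_global:
  assumes "\<And>i j. i \<in> {1..m} \<Longrightarrow> j \<in> {1..n} \<Longrightarrow> twice_differentiable (\<lambda>w. \<phi> w (zs i j))"
    and i: "i \<in> {1..m}"
  shows "hessian (local_loss \<phi> lam n (zs i)) w - hessian (global_loss \<phi> lam m n zs) w =
    (1 / real m) *\<^sub>R (\<Sum>k = 1..m. (1 / real n) *\<^sub>R (\<Sum>j = 1..n.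
       hessian (\<lambda>w. \<phi> w (zs i j)) w - hessian (\<lambda>w. \<phi> w (zs k j)) w))"
proof -
  let ?H = "\<lambda>k w. (1 / real n) *\<^sub>R (\<Sum>j = 1..n. hessian (\<lambda>w. \<phi> w (zs k j)) w) + lam *\<^sub>R mat 1"
  have loc: "k \<in> {1..m} \<Longrightarrow> has_gradient_hessian (local_loss \<phi> lam n (zs k))
      (gradient (local_loss \<phi> lam n (zs k))) (?H k)" for k
    using assms by (intro has_gradient_hessian_local_loss)
  have "has_gradient_hessian (global_loss \<phi> lam m n zs)
    (\<lambda>w. (1 / real m) *\<^sub>R (\<Sum>k = 1..m. gradient (local_loss \<phi> lam n (zs k)) w))
    (\<lambda>w. (1 / real m) *\<^sub>R (\<Sum>k = 1..m. ?H k w))"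
    unfolding global_loss_def[abs_def]
    by (intro has_gradient_hessian_scale has_gradient_hessian_sum loc)
  from has_gradient_hessian_unique(2)[OF this]
  have "hessian (local_loss \<phi> lam n (zs i)) w - hessian (global_loss \<phi> lam m n zs) w =
    ?H i w - (1 / real m) *\<^sub>R (\<Sum>k = 1..m. ?H k w)"
    by (simp only: has_gradient_hessian_unique(2)[OF loc[OF i]])
  \<comment> \<open>Written as an average of \<open>m\<close> equal copies, the local Hessian can be
    subtracted term by term; membership of \<open>i\<close> in the index range makes
    \<open>m\<close> positive.\<close>
  also have "?H i w = (1 / real m) *\<^sub>R (\<Sum>k = 1..m. ?H i w)"
    using i by (simp only: sum_constant_scaleR) simp
  finally show ?thesis
    by (simp add: scaleR_diff_right[symmetric] sum_subtractf[symmetric] del: sum_constant)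
qed

section \<open>Symmetry and positivity of Hessians\<close>

lemma has_derivative_remainder:
  fixes f :: "'a::real_normed_vector \<Rightarrow> 'b::real_normed_vector"
  assumes "(f has_derivative f') (at w)" "0 < e"
  obtains \<rho> where "0 < \<rho>" "\<And>y. norm y < \<rho> \<Longrightarrow> norm (f (w + y) - f w - f' y) \<le> e * norm y"
proof -
  obtain \<rho> where "0 < \<rho>" and
    "\<And>y. norm (y - w) < \<rho> \<Longrightarrow> norm (f y - f w - f' (y - w)) \<le> e * norm (y - w)"
    using assms unfolding has_derivative_at_alt by meson
  then show ?thesis using that[of \<rho>] by (metis add_diff_cancel_left')
qed

text \<open>The mean value theorem in direction \<open>u\<close> leaves a difference of two
  gradients, and both are expanded around \<open>w\<close>. The error therefore depends on the
  expansion of \<open>\<gamma>\<close> at \<open>w\<close> alone.\<close>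

lemma second_difference_bound:
  fixes H :: "real^'n^'n"
  assumes g: "\<And>w. (g has_derivative (\<lambda>h. \<gamma> w \<bullet> h)) (at w)"
    and rem: "\<And>y. norm y < \<rho> \<Longrightarrow> norm (\<gamma> (w + y) - \<gamma> w - H *v y) \<le> e * norm y"
    and t: "0 < t" "t * (norm u + norm v) < \<rho>" and e: "0 \<le> e"
  shows "\<bar>g (w + t *\<^sub>R u + t *\<^sub>R v) - g (w + t *\<^sub>R u) - g (w + t *\<^sub>R v) + g w - t\<^sup>2 * ((H *v v) \<bullet> u)\<bar>
    \<le> t\<^sup>2 * (2 * e * (norm u + norm v) * norm u)"
proof -
  let ?K = "norm u + norm v"
  define \<psi> where "\<psi> s = g (w + s *\<^sub>R u + t *\<^sub>R v) - g (w + s *\<^sub>R u)" for s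
    \<comment> \<open>the second difference is \<open>\<psi> t - \<psi> 0\<close>, to which the mean value theorem applies\<close>
  have der: "(\<psi> has_derivative (\<lambda>h. h * ((\<gamma> (w + s *\<^sub>R u + t *\<^sub>R v) - \<gamma> (w + s *\<^sub>R u)) \<bullet> u))) (at s)" for s
  proof -
    have comp: "((\<lambda>s. g (a + s *\<^sub>R u)) has_derivative (\<lambda>h. \<gamma> (a + s *\<^sub>R u) \<bullet> (h *\<^sub>R u))) (at s)" for a
      by (rule has_derivative_compose[where f = "\<lambda>s. a + s *\<^sub>R u" and g = g, OF _ g])
        (auto intro!: derivative_eq_intros)
    have "((\<lambda>s. g (w + s *\<^sub>R u + t *\<^sub>R v)) has_derivative
        (\<lambda>h. \<gamma> (w + s *\<^sub>R u + t *\<^sub>R v) \<bullet> (h *\<^sub>R u))) (at s)"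
      "((\<lambda>s. g (w + s *\<^sub>R u)) has_derivative (\<lambda>h. \<gamma> (w + s *\<^sub>R u) \<bullet> (h *\<^sub>R u))) (at s)"
      using comp[of "w + t *\<^sub>R v"] comp[of w] by (simp_all add: add_ac)
    from has_derivative_diff[OF this] show ?thesis
      by (simp add: \<psi>_def[abs_def] inner_diff_left right_diff_distrib)
  qed
  obtain \<xi> where \<xi>: "0 < \<xi>" "\<xi> < t"
    "\<psi> t - \<psi> 0 = (t - 0) * ((\<gamma> (w + \<xi> *\<^sub>R u + t *\<^sub>R v) - \<gamma> (w + \<xi> *\<^sub>R u)) \<bullet> u)"
    using mvt_simple[OF t(1), of \<psi> "\<lambda>s h. h * ((\<gamma> (w + s *\<^sub>R u + t *\<^sub>R v) - \<gamma> (w + s *\<^sub>R u)) \<bullet> u)"]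
      has_derivative_at_withinI[OF der] by auto
  define E1 where "E1 = \<gamma> (w + (\<xi> *\<^sub>R u + t *\<^sub>R v)) - \<gamma> w - H *v (\<xi> *\<^sub>R u + t *\<^sub>R v)"
  define E2 where "E2 = \<gamma> (w + \<xi> *\<^sub>R u) - \<gamma> w - H *v (\<xi> *\<^sub>R u)"
  have le1: "norm (\<xi> *\<^sub>R u + t *\<^sub>R v) \<le> t * ?K"
    using norm_triangle_ineq[of "\<xi> *\<^sub>R u" "t *\<^sub>R v"] \<xi>(1,2) t(1) mult_right_mono[of \<xi> t "norm u"]
    by (simp add: distrib_left)
  have le2: "norm (\<xi> *\<^sub>R u) \<le> t * ?K"
    using \<xi>(1,2) t(1) mult_right_mono[of \<xi> t "norm u"]
    by (simp add: distrib_left add_increasing2)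
  have E1: "norm E1 \<le> e * (t * ?K)"
    unfolding E1_def
    by (rule order_trans[OF rem[OF order.strict_trans1[OF le1 t(2)]] mult_left_mono[OF le1 e]])
  have E2: "norm E2 \<le> e * (t * ?K)"
    unfolding E2_def
    by (rule order_trans[OF rem[OF order.strict_trans1[OF le2 t(2)]] mult_left_mono[OF le2 e]])
  have split: "\<gamma> (w + \<xi> *\<^sub>R u + t *\<^sub>R v) - \<gamma> (w + \<xi> *\<^sub>R u) = t *\<^sub>R (H *v v) + (E1 - E2)"
    unfolding E1_def E2_def
    by (simp add: matrix_vector_right_distrib matrix_vector_mult_scaleR add.assoc)
  have "g (w + t *\<^sub>R u + t *\<^sub>R v) - g (w + t *\<^sub>R u) - g (w + t *\<^sub>R v) + g w = \<psi> t - \<psi> 0"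
    by (simp add: \<psi>_def)
  also have "\<dots> = t\<^sup>2 * ((H *v v) \<bullet> u) + t * ((E1 - E2) \<bullet> u)"
    unfolding \<xi>(3) split by (simp add: inner_add_left power2_eq_square algebra_simps)
  finally have "\<bar>g (w + t *\<^sub>R u + t *\<^sub>R v) - g (w + t *\<^sub>R u) - g (w + t *\<^sub>R v) + g w - t\<^sup>2 * ((H *v v) \<bullet> u)\<bar>
      = t * \<bar>(E1 - E2) \<bullet> u\<bar>" using t by (simp add: abs_mult)
  also have "\<dots> \<le> t * ((2 * (e * (t * ?K))) * norm u)"
  proof -
    have "\<bar>(E1 - E2) \<bullet> u\<bar> \<le> norm (E1 - E2) * norm u" by (rule Cauchy_Schwarz_ineq2)
    also have "\<dots> \<le> (2 * (e * (t * ?K))) * norm u"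
      using norm_triangle_ineq4[of E1 E2] E1 E2 by (intro mult_right_mono) auto
    finally show ?thesis using t by (intro mult_left_mono) auto
  qed
  finally show ?thesis by (simp add: power2_eq_square mult_ac)
qed

text \<open>The second difference of \<open>g\<close> is symmetric in the two directions, and
  divided by \<open>t\<^sup>2\<close> it approximates both mixed forms.\<close>

lemma transpose_hessian:
  assumes "has_gradient_hessian g \<gamma> H"
  shows "transpose (H w) = H w"
proof -
  have g: "\<And>w. (g has_derivative (\<lambda>h. \<gamma> w \<bullet> h)) (at w)"
    and \<gamma>: "(\<gamma> has_derivative (\<lambda>h. H w *v h)) (at w)"
    using assms by (auto simp: has_gradient_hessian_def)
  have sym: "(H w *v v) \<bullet> u = (H w *v u) \<bullet> v" for u v
  proof -
    let ?K = "norm u + norm v"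
    have "\<bar>(H w *v v) \<bullet> u - (H w *v u) \<bullet> v\<bar> \<le> 0 + e" if e: "0 < e" for e
    proof -
      \<comment> \<open>The total error will be \<open>2 * e' * ?K\<^sup>2\<close>; the added 1
        keeps the denominator positive when both vectors vanish.\<close>
      define e' where "e' = e / (2 * (?K\<^sup>2 + 1))"
      have e': "0 < e'" using e by (simp add: e'_def add_nonneg_pos)
      obtain \<rho> where \<rho>: "0 < \<rho>"
        and rem: "\<And>y. norm y < \<rho> \<Longrightarrow> norm (\<gamma> (w + y) - \<gamma> w - H w *v y) \<le> e' * norm y"
        using has_derivative_remainder[OF \<gamma> e'] by metis
      define t where "t = \<rho> / (?K + 1)"
      have K: "0 \<le> ?K" by simp
      have t: "0 < t" using \<rho> K by (simp add: t_def add_nonneg_pos)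
      have tK: "t * ?K < \<rho>" using \<rho> K add_nonneg_pos[OF K zero_less_one] by (simp add: t_def field_simps)
      let ?S = "g (w + t *\<^sub>R u + t *\<^sub>R v) - g (w + t *\<^sub>R u) - g (w + t *\<^sub>R v) + g w"
      have 1: "\<bar>?S - t\<^sup>2 * ((H w *v v) \<bullet> u)\<bar> \<le> t\<^sup>2 * (2 * e' * ?K * norm u)"
        using second_difference_bound[OF g rem t tK] e' by simp
      have 2: "\<bar>?S - t\<^sup>2 * ((H w *v u) \<bullet> v)\<bar> \<le> t\<^sup>2 * (2 * e' * ?K * norm v)"
      proof -
        have K': "t * (norm v + norm u) < \<rho>" using tK by (simp add: add.commute)
        have "g (w + t *\<^sub>R v + t *\<^sub>R u) - g (w + t *\<^sub>R v) - g (w + t *\<^sub>R u) + g w = ?S"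
          by (simp add: add_ac)
        then show ?thesis
          using second_difference_bound[OF g rem t K' less_imp_le[OF e']]
          by (simp only: add.commute[of "norm v" "norm u"])
      qed
      have "t\<^sup>2 * \<bar>(H w *v v) \<bullet> u - (H w *v u) \<bullet> v\<bar>
          = \<bar>t\<^sup>2 * ((H w *v v) \<bullet> u) - t\<^sup>2 * ((H w *v u) \<bullet> v)\<bar>"
        by (simp only: right_diff_distrib[symmetric] abs_mult abs_power2)
      also have "\<dots> \<le> t\<^sup>2 * (2 * e' * ?K * norm u) + t\<^sup>2 * (2 * e' * ?K * norm v)"
        using 1 2 by linarith
      also have "\<dots> = t\<^sup>2 * (2 * e' * ?K\<^sup>2)"
        by algebra
      finally have "\<bar>(H w *v v) \<bullet> u - (H w *v u) \<bullet> v\<bar> \<le> 2 * e' * ?K\<^sup>2"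
        by (rule mult_left_le_imp_le) (use t in simp)
      also have "\<dots> \<le> e"
      proof -
        have "0 < ?K\<^sup>2 + 1" by (simp add: add_nonneg_pos)
        then have "e = e' * (2 * (?K\<^sup>2 + 1))" by (simp add: e'_def)
        also have "\<dots> = 2 * e' * ?K\<^sup>2 + 2 * e'" by algebra
        finally show ?thesis using e' by linarith
      qed
      finally show ?thesis by simp
    qed
    then show ?thesis using field_le_epsilon[of "\<bar>(H w *v v) \<bullet> u - (H w *v u) \<bullet> v\<bar>" 0] by simp
  qed
  have entry: "(H w *v axis j 1) \<bullet> axis i 1 = H w $ i $ j" for i j
    by (simp add: inner_axis matrix_vector_mult_basis column_def)
  have "H w $ j $ i = H w $ i $ j" for i j
    using sym[of "axis j 1" "axis i 1"] by (simp only: entry)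
  then show ?thesis by (simp add: transpose_def vec_eq_iff)
qed

text \<open>Adding the tangent inequalities at \<open>u\<close> and at \<open>w\<close> cancels the
  values of \<open>g\<close>. Each comes from convexity on the line through the two points.\<close>

lemma convex_gradient_monotone:
  fixes g :: "real^'n \<Rightarrow> real"
  assumes conv: "convex_on UNIV g" and g: "\<And>w. (g has_derivative (\<lambda>h. \<gamma> w \<bullet> h)) (at w)"
  shows "0 \<le> (\<gamma> u - \<gamma> w) \<bullet> (u - w)"
proof -
  have tangent: "\<gamma> a \<bullet> (b - a) \<le> g b - g a" for a b
  proof -
    let ?f = "\<lambda>t. g (a + t *\<^sub>R (b - a))"
    have cf: "convex_on UNIV ?f"
    proof (rule convex_onI)
      fix t x y :: real assume t: "0 < t" "t < 1"
      have "a + ((1 - t) * x + t * y) *\<^sub>R (b - a) = (1 - t) *\<^sub>R (a + x *\<^sub>R (b - a)) + t *\<^sub>R (a + y *\<^sub>R (b - a))"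
        by (simp add: algebra_simps)
      then show "?f ((1 - t) *\<^sub>R x + t *\<^sub>R y) \<le> (1 - t) * ?f x + t * ?f y"
        using convex_onD[OF conv, of t "a + x *\<^sub>R (b - a)" "a + y *\<^sub>R (b - a)"] t by simp
    qed simp
    have "(?f has_derivative (\<lambda>h. \<gamma> (a + 0 *\<^sub>R (b - a)) \<bullet> (h *\<^sub>R (b - a)))) (at 0)"
      by (rule has_derivative_compose[where f = "\<lambda>t. a + t *\<^sub>R (b - a)" and g = g, OF _ g])
        (auto intro!: derivative_eq_intros)
    then have "(?f has_field_derivative (\<gamma> a \<bullet> (b - a))) (at 0)"
      by (simp add: has_field_derivative_def mult_commute_abs)
    then show ?thesis
      using convex_on_imp_above_tangent[OF cf, of 0 1] by simp
  qed
  show ?thesis using tangent[of u w] tangent[of w u] by (simp add: inner_diff_left inner_diff_right)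
qed

text \<open>Monotonicity of the gradient is applied to a small step along \<open>x\<close>.
  Replacing the gradient increment by its linearisation and dividing by \<open>t\<^sup>2\<close>
  leaves the quadratic form up to an error \<open>e\<close>.\<close>

lemma hessian_psd:
  assumes conv: "convex_on UNIV g" and gh: "has_gradient_hessian g \<gamma> H"
  shows "0 \<le> x \<bullet> (H w *v x)"
proof -
  have \<gamma>: "(\<gamma> has_derivative (\<lambda>h. H w *v h)) (at w)"
    using gh by (auto simp: has_gradient_hessian_def)
  have "0 \<le> x \<bullet> (H w *v x) + e" if e: "0 < e" for e
  proof -
    define e' where "e' = e / ((norm x)\<^sup>2 + 1)"
    have e': "0 < e'" using e by (simp add: e'_def add_nonneg_pos)
    obtain \<rho> where \<rho>: "0 < \<rho>"
      and rem: "\<And>y. norm y < \<rho> \<Longrightarrow> norm (\<gamma> (w + y) - \<gamma> w - H w *v y) \<le> e' * norm y"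
      using has_derivative_remainder[OF \<gamma> e'] by metis
    define t where "t = \<rho> / (norm x + 1)"
    have t: "0 < t" using \<rho> by (simp add: t_def add_nonneg_pos)
    have tx: "norm (t *\<^sub>R x) < \<rho>" using \<rho> add_nonneg_pos[OF norm_ge_zero[of x] zero_less_one] by (simp add: t_def field_simps)
    have "0 \<le> (\<gamma> (w + t *\<^sub>R x) - \<gamma> w) \<bullet> (t *\<^sub>R x)"
      using convex_gradient_monotone[OF conv, of \<gamma> "w + t *\<^sub>R x" w] gh
      by (simp add: has_gradient_hessian_def)
    also have "\<dots> = (\<gamma> (w + t *\<^sub>R x) - \<gamma> w - H w *v (t *\<^sub>R x)) \<bullet> (t *\<^sub>R x) + t\<^sup>2 * (x \<bullet> (H w *v x))"
      by (simp add: inner_diff_left inner_diff_right matrix_vector_mult_scaleR power2_eq_square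
          inner_commute algebra_simps)
    also have "\<dots> \<le> (e' * norm (t *\<^sub>R x)) * norm (t *\<^sub>R x) + t\<^sup>2 * (x \<bullet> (H w *v x))"
      using rem[OF tx] by (intro add_right_mono order_trans[OF norm_cauchy_schwarz] mult_right_mono) auto
    also have "\<dots> = t\<^sup>2 * (e' * (norm x)\<^sup>2 + x \<bullet> (H w *v x))"
      using t by (simp add: power2_eq_square algebra_simps)
    finally have "0 \<le> e' * (norm x)\<^sup>2 + x \<bullet> (H w *v x)"
      using t by (simp add: zero_le_mult_iff)
    moreover have "e' * (norm x)\<^sup>2 \<le> e"
      using e by (simp add: e'_def divide_simps add_nonneg_pos)
    ultimately show ?thesis by linarith
  qed
  then show ?thesis by (rule field_le_epsilon)
qed

text \<open>Polarisation writes the bilinear form of a symmetric matrix as a difference of two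
  values of the quadratic form, and the parallelogram law adds up their bounds.\<close>

lemma symmetric_quadratic_form_bound:
  fixes A :: "real^'n^'n"
  assumes sym: "transpose A = A" and q: "\<And>x. \<bar>x \<bullet> (A *v x)\<bar> \<le> c * (norm x)\<^sup>2"
  shows "norm (A *v x) \<le> c * norm x"
proof (cases "A *v x = 0 \<or> x = 0")
  case True
  \<comment> \<open>Nonnegativity of \<open>c\<close> is recovered from \<open>q\<close> when
    \<open>x\<close> is nonzero.\<close>
  have "0 \<le> c * norm x"
  proof (cases "x = 0")
    case False
    then show ?thesis using order_trans[OF abs_ge_zero q[of x]] by (simp add: zero_le_mult_iff)
  qed simp
  then show ?thesis using True by auto
next
  case False
  let ?N = "norm (A *v x)"
  \<comment> \<open>This is \<open>A *v x\<close> rescaled to the length of \<open>x\<close>, so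
    that \<open>y \<bullet> (A *v x)\<close> is the product of the norms of \<open>x\<close> and
    \<open>A *v x\<close>.\<close>
  define y where "y = (norm x / ?N) *\<^sub>R (A *v x)"
  have ny: "norm y = norm x" using False by (simp add: y_def)
  have xy: "x \<bullet> (A *v y) = y \<bullet> (A *v x)"
    by (metis inner_commute inner_matrix_vector_transpose sym)
  have "4 * (y \<bullet> (A *v x)) = (x + y) \<bullet> (A *v (x + y)) - (x - y) \<bullet> (A *v (x - y))"
    by (simp add: matrix_vector_right_distrib matrix_vector_mult_diff_distrib inner_add_left
        inner_add_right inner_diff_left inner_diff_right xy)
  also have "\<dots> \<le> c * (norm (x + y))\<^sup>2 + c * (norm (x - y))\<^sup>2"
    using q[of "x + y"] q[of "x - y"] by linarith
  also have "\<dots> = 4 * c * (norm x)\<^sup>2"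
    using ny by (simp add: power2_norm_eq_inner inner_add_left inner_add_right inner_diff_left
        inner_diff_right inner_commute algebra_simps norm_eq)
  finally have "y \<bullet> (A *v x) \<le> c * (norm x)\<^sup>2" by simp
  moreover have "y \<bullet> (A *v x) = norm x * ?N"
    using False by (simp add: y_def power2_norm_eq_inner[symmetric] power2_eq_square)
  ultimately have "norm x * ?N \<le> norm x * (c * norm x)"
    by (simp add: power2_eq_square mult_ac)
  then show ?thesis using False by simp
qed

text \<open>Both quadratic forms lie between 0 and \<open>c * (norm x)\<^sup>2\<close>, so their
  difference is at most this in absolute value. The triangle inequality would only give
  \<open>2 * c\<close>.\<close>

lemma norm_diff_psd_le:
  fixes A B :: "real^'n^'n"
  assumes "transpose A = A" "transpose B = B"
    and "\<And>x. 0 \<le> x \<bullet> (A *v x)" "\<And>x. 0 \<le> x \<bullet> (B *v x)"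
    and "spectral_norm A \<le> c" "spectral_norm B \<le> c"
  shows "norm ((A - B) *v x) \<le> c * norm x"
proof (rule symmetric_quadratic_form_bound)
  show "transpose (A - B) = A - B"
    using assms(1,2) by (simp add: transpose_def vec_eq_iff)
  have up: "x \<bullet> (C *v x) \<le> c * (norm x)\<^sup>2" if "spectral_norm C \<le> c" for C :: "real^'n^'n" and x
  proof -
    have "x \<bullet> (C *v x) \<le> norm x * norm (C *v x)" by (rule norm_cauchy_schwarz)
    also have "\<dots> \<le> norm x * (c * norm x)"
      using norm_matrix_vector_le_spectral_norm[of C x] mult_right_mono[OF that norm_ge_zero[of x]]
      by (intro mult_left_mono) auto
    finally show ?thesis by (simp add: power2_eq_square mult_ac)
  qed
  show "\<bar>x \<bullet> ((A - B) *v x)\<bar> \<le> c * (norm x)\<^sup>2" for x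
    using up[OF assms(5), of x] up[OF assms(6), of x] assms(3,4)[of x]
    by (simp add: matrix_vector_mult_diff_rdistrib inner_diff_right)
qed

section \<open>Measurability of Hessians\<close>

text \<open>A fixed sequence of step sizes is used because measurability passes to limits of
  sequences.\<close>

lemma has_derivative_difference_quotient_LIMSEQ:
  fixes f :: "'a::real_normed_vector \<Rightarrow> real"
  assumes "(f has_derivative f') (at w)"
  shows "(\<lambda>N. (f (w + inverse (real (Suc N)) *\<^sub>R h) - f w) / inverse (real (Suc N))) \<longlonglongrightarrow> f' h"
proof -
  have f': "f' (x *\<^sub>R h) = f' h * x" for x
    using linear_scale[OF has_derivative_linear[OF assms]] by (simp add: mult.commute)
  have "((\<lambda>t. f (w + t *\<^sub>R h)) has_derivative (\<lambda>x. f' (x *\<^sub>R h))) (at 0)"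
    by (rule has_derivative_compose[where f = "\<lambda>t. w + t *\<^sub>R h" and g = f])
      (use assms in \<open>auto intro!: derivative_eq_intros\<close>)
  then have "((\<lambda>t. f (w + t *\<^sub>R h)) has_field_derivative f' h) (at 0)"
    by (simp add: has_field_derivative_def f' )
  then have "((\<lambda>t. (f (w + t *\<^sub>R h) - f w) / t) \<longlongrightarrow> f' h) (at 0)"
    by (simp add: DERIV_def)
  moreover have "filterlim (\<lambda>N. inverse (real (Suc N))) (at 0) sequentially"
    by (simp add: filterlim_at LIMSEQ_inverse_real_of_nat del: of_nat_Suc)
  ultimately show ?thesis by (rule filterlim_compose)
qed

text \<open>Two rounds of difference quotients: gradient entries are pointwise limits of measurable
  functions of \<open>z\<close>, and Hessian entries are limits of quotients of gradient
  entries.\<close>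

lemma borel_measurable_hessian:
  fixes \<phi> :: "real^'n \<Rightarrow> 'z \<Rightarrow> real"
  assumes meas: "\<And>w. (\<lambda>z. \<phi> w z) \<in> borel_measurable D"
    and diff: "\<And>z. z \<in> space D \<Longrightarrow> twice_differentiable (\<lambda>w. \<phi> w z)"
  shows "(\<lambda>z. hessian (\<lambda>w. \<phi> w z) w) \<in> borel_measurable D"
proof -
  note gh = twice_differentiable_has_gradient_hessian[OF diff, unfolded has_gradient_hessian_def]
  have grad: "(\<lambda>z. gradient (\<lambda>w. \<phi> w z) w $ k) \<in> borel_measurable D" for k w
  proof (rule borel_measurable_LIMSEQ_real)
    fix z assume "z \<in> space D"
    then show "(\<lambda>N. (\<phi> (w + inverse (real (Suc N)) *\<^sub>R axis k 1) z - \<phi> w z) / inverse (real (Suc N)))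
        \<longlonglongrightarrow> gradient (\<lambda>w. \<phi> w z) w $ k"
      using has_derivative_difference_quotient_LIMSEQ[OF gh[THEN conjunct1, rule_format], of z w "axis k 1"]
      by (simp add: inner_axis)
  qed (use meas in measurable)
  have hess: "(\<lambda>z. hessian (\<lambda>w. \<phi> w z) w $ k $ l) \<in> borel_measurable D" for k l
  proof (rule borel_measurable_LIMSEQ_real)
    fix z assume z: "z \<in> space D"
    have "((\<lambda>w. gradient (\<lambda>w. \<phi> w z) w $ k) has_derivative
        (\<lambda>h. (hessian (\<lambda>w. \<phi> w z) w *v h) $ k)) (at w)"
      using gh[OF z] by (intro bounded_linear.has_derivative[OF bounded_linear_vec_nth]) auto
    from has_derivative_difference_quotient_LIMSEQ[OF this, of "axis l 1"]
    show "(\<lambda>N. (gradient (\<lambda>w. \<phi> w z) (w + inverse (real (Suc N)) *\<^sub>R axis l 1) $ k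
          - gradient (\<lambda>w. \<phi> w z) w $ k) / inverse (real (Suc N)))
        \<longlonglongrightarrow> hessian (\<lambda>w. \<phi> w z) w $ k $ l"
      by (simp add: matrix_vector_mult_basis column_def)
  qed (use grad in measurable)
  show ?thesis
    unfolding borel_measurable_euclidean_space[where f = "\<lambda>z. hessian (\<lambda>w. \<phi> w z) w"]
    using hess by (auto simp: Basis_vec_def inner_axis)
qed

section \<open>Uniform deviation over a ball\<close>

text \<open>Volume comparison: the balls of radius \<open>e / 2\<close> around the points are
  disjoint and lie in the ball of radius \<open>r + e / 2\<close>.\<close>

lemma separated_subset_card_le:
  fixes S :: "'a::euclidean_space set"
  assumes "finite S" "S \<subseteq> cball 0 r" and e: "0 < e" and r: "0 \<le> r"
    and sep: "\<And>x y. x \<in> S \<Longrightarrow> y \<in> S \<Longrightarrow> x \<noteq> y \<Longrightarrow> e < dist x y"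
  shows "real (card S) \<le> (1 + 2 * r / e) ^ DIM('a)"
proof -
  let ?V = "unit_ball_vol (real DIM('a))"
  have V: "?V > 0" by simp
  have disj: "disjoint_family_on (\<lambda>x. ball x (e / 2)) S"
    unfolding disjoint_family_on_def
  proof (intro ballI impI, rule ccontr)
    fix x y assume *: "x \<in> S" "y \<in> S" "x \<noteq> y" "ball x (e / 2) \<inter> ball y (e / 2) \<noteq> {}"
    then obtain z where "dist x z < e / 2" "dist y z < e / 2" by auto
    then have "dist x y < e" using dist_triangle2[of x y z] by linarith
    then show False using sep[of x y] * by simp
  qed
  have "real (card S) * (?V * (e / 2) ^ DIM('a)) = (\<Sum>x\<in>S. measure lborel (ball x (e / 2)))"
    using e by (simp add: content_ball)
  also have "\<dots> = measure lborel (\<Union>x\<in>S. ball x (e / 2))"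
    using assms(1) disj by (intro measure_finite_Union[symmetric]) (auto simp: emeasure_ball e less_imp_le)
  also have "\<dots> \<le> measure lborel (ball (0 :: 'a) (r + e / 2))"
  proof (rule measure_mono_fmeasurable)
    show "(\<Union>x\<in>S. ball x (e / 2)) \<subseteq> ball 0 (r + e / 2)"
    proof
      fix z assume "z \<in> (\<Union>x\<in>S. ball x (e / 2))"
      then obtain x where "x \<in> S" "dist x z < e / 2" by auto
      then show "z \<in> ball 0 (r + e / 2)"
        using assms(2) dist_triangle[of 0 z x] by fastforce
    qed
  qed (use assms(1) e r in \<open>auto intro!: fmeasurableI simp: emeasure_ball\<close>)
  also have "\<dots> = ?V * (r + e / 2) ^ DIM('a)"
    using e r by (simp add: content_ball)
  finally have "?V * (real (card S) * (e / 2) ^ DIM('a)) \<le> ?V * (r + e / 2) ^ DIM('a)"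
    by (simp only: mult.left_commute)
  then have "real (card S) * (e / 2) ^ DIM('a) \<le> (r + e / 2) ^ DIM('a)"
    using V by (rule mult_left_le_imp_le)
  also have "r + e / 2 = (1 + 2 * r / e) * (e / 2)"
    using e by (simp add: distrib_right)
  finally have "real (card S) * (e / 2) ^ DIM('a) \<le> (1 + 2 * r / e) ^ DIM('a) * (e / 2) ^ DIM('a)"
    by (simp only: power_mult_distrib)
  then show ?thesis
    by (rule mult_right_le_imp_le) (use e in simp)
qed

text \<open>A separated set of greatest cardinality is a net, since a point far from all of it could
  be added. The volume bound guarantees that such a set exists.\<close>

lemma cball_net:
  assumes e: "0 < e" and r: "0 \<le> r"
  obtains N :: "'a::euclidean_space set" where "finite N" "N \<subseteq> cball 0 r"
    "real (card N) \<le> (1 + 2 * r / e) ^ DIM('a)"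
    "\<And>w. w \<in> cball 0 r \<Longrightarrow> \<exists>u\<in>N. dist w u \<le> e"
proof -
  define P where "P S \<longleftrightarrow> finite S \<and> S \<subseteq> cball 0 r \<and> (\<forall>x\<in>S. \<forall>y\<in>S. x \<noteq> y \<longrightarrow> e < dist x y)"
    for S :: "'a set"
  let ?B = "(1 + 2 * r / e) ^ DIM('a)"
  have bound: "real (card S) \<le> ?B" if "P S" for S
    using separated_subset_card_le[of S r e] that e r by (auto simp: P_def)
  have le: "\<forall>S. P S \<longrightarrow> card S < Suc (nat \<lfloor>?B\<rfloor>)"
    using bound by (auto simp: less_Suc_eq_le intro: le_nat_floor)
  have "P {}" by (simp add: P_def)
  from ex_has_greatest_nat[OF this le] obtain N
    where N: "P N" and max: "\<And>S. P S \<Longrightarrow> card S \<le> card N" by blast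
  have "\<exists>u\<in>N. dist w u \<le> e" if w: "w \<in> cball 0 r" for w
  proof (rule ccontr)
    assume "\<not> ?thesis"
    then have far: "\<And>u. u \<in> N \<Longrightarrow> e < dist w u" by force
    then have "w \<notin> N" using e by force
    moreover have "P (insert w N)"
      using N w far by (auto simp: P_def dist_commute)
    ultimately show False using max[of "insert w N"] N by (simp add: P_def)
  qed
  then show ?thesis using that N bound[OF N] unfolding P_def by blast
qed

lemma spectral_norm_scaleR: "spectral_norm (c *\<^sub>R A) = \<bar>c\<bar> * spectral_norm A"
  unfolding spectral_norm_def scaleR_matrix_vector_assoc[symmetric]
  by (rule onorm_scaleR) (simp add: linear_conv_bounded_linear[symmetric])

lemma spectral_norm_zero [simp]: "spectral_norm 0 = 0"
  using spectral_norm_scaleR[of 0 0] by simp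

lemma spectral_norm_sum: "spectral_norm (\<Sum>i\<in>I. A i) \<le> (\<Sum>i\<in>I. spectral_norm (A i))"
  by (induction I rule: infinite_finite_induct)
    (auto intro: order_trans[OF spectral_norm_triangle])

lemma spectral_norm_average_le:
  assumes "I \<noteq> {}" "finite I" "\<And>k. k \<in> I \<Longrightarrow> spectral_norm (A k) \<le> c"
  shows "spectral_norm ((1 / real (card I)) *\<^sub>R (\<Sum>k\<in>I. A k)) \<le> c"
proof -
  have "spectral_norm (\<Sum>k\<in>I. A k) \<le> real (card I) * c"
    using order_trans[OF spectral_norm_sum sum_bounded_above] assms(3) by blast
  then show ?thesis
    using assms(1,2) by (simp add: spectral_norm_scaleR card_gt_0_iff pos_divide_le_eq mult.commute)
qed

section \<open>Exchanging samples between two groups\<close>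

text \<open>Exchanging the coordinates \<open>(i, j)\<close> and \<open>(k, j)\<close> negates the
  difference with index \<open>j\<close> and touches no other, so \<open>tail_bound\<close> applies
  with \<open>n\<close> summands.\<close>

lemma product_swap_tail_bound:
  fixes H :: "'z \<Rightarrow> real^'n^'n" and i k :: 'i and n :: nat
  assumes "prob_space D" and finI: "finite I" and ik: "i \<in> I" "k \<in> I" "i \<noteq> k"
    and meas: "H \<in> borel_measurable D"
    and sym: "\<And>z. z \<in> space D \<Longrightarrow> transpose (H z) = H z"
    and bound: "\<And>z z' x. z \<in> space D \<Longrightarrow> z' \<in> space D \<Longrightarrow> norm ((H z - H z') *v x) \<le> c * norm x"
    and c: "0 < c" and n: "1 \<le> n" and s: "0 \<le> s"
  defines "Q \<equiv> Pi\<^sub>M (I \<times> {1..n}) (\<lambda>_. D)"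
  shows "measure Q {\<omega> \<in> space Q. s < spectral_norm (\<Sum>j = 1..n. H (\<omega> (i, j)) - H (\<omega> (k, j)))}
    \<le> 2 * real CARD('n) * exp (- (s\<^sup>2 / (2 * (real n * c\<^sup>2))))"
proof -
  interpret D: prob_space D by fact
  interpret prod: product_prob_space "\<lambda>_. D" "I \<times> {1..n}" by unfold_locales
  let ?J = "I \<times> {1..n}"
  define \<sigma> where "\<sigma> j p = (if p = (i, j) then (k, j) else if p = (k, j) then (i, j) else p)" for j and p :: "'i \<times> nat"
  define T where "T j \<omega> = (\<lambda>p\<in>?J. \<omega> (\<sigma> j p))" for j and \<omega> :: "'i \<times> nat \<Rightarrow> 'z"
  define A where "A j \<omega> = H (\<omega> (i, j)) - H (\<omega> (k, j))" for j :: nat and \<omega> :: "'i \<times> nat \<Rightarrow> 'z"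
  have pspace: "\<omega> p \<in> space D" if "\<omega> \<in> space Q" "p \<in> ?J" for \<omega> p
    using that by (auto simp: Q_def space_PiM)
  have \<sigma>: "\<sigma> j \<in> ?J \<rightarrow> ?J" if "j \<in> {1..n}" for j
    using that ik by (auto simp: \<sigma>_def)
  have T_apply: "T j \<omega> p = \<omega> (\<sigma> j p)" if "p \<in> ?J" for j \<omega> p
    using that by (simp add: T_def)
  interpret Q: prob_space Q unfolding Q_def by (rule prod.P.prob_space_axioms)
  interpret F: flip_symmetric_matrices Q "{1..n}" A T c
  proof unfold_locales
    fix j assume j: "j \<in> {1..n}"
    have p: "(i, j) \<in> ?J" "(k, j) \<in> ?J" using j ik by auto
    have comp: "(\<lambda>\<omega>. \<omega> p) \<in> measurable Q D" if "p \<in> ?J" for p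
      unfolding Q_def using that by (rule measurable_component_singleton)
    show "A j \<in> borel_measurable Q"
      unfolding A_def by (intro borel_measurable_diff measurable_compose[OF _ meas] comp p)
    show "T j \<in> measurable Q Q"
    proof -
      have "T j \<in> measurable Q (Pi\<^sub>M ?J (\<lambda>_. D))"
        unfolding T_def by (intro measurable_restrict comp funcset_mem[OF \<sigma>[OF j]])
      then show ?thesis by (simp add: Q_def)
    qed
    \<comment> \<open>All factors of the product equal \<open>D\<close>, so reindexing by the
      injective map \<open>\<sigma> j\<close> preserves it.\<close>
    show "distr Q Q (T j) = Q"
      unfolding Q_def T_def
      using distr_PiM_reindex[of ?J "\<lambda>_. D" "\<sigma> j" ?J] \<sigma>[OF j] D.prob_space_axioms
      by (auto simp: inj_on_def \<sigma>_def split: if_splits)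
    fix \<omega> assume \<omega>: "\<omega> \<in> space Q"
    show "transpose (A j \<omega>) = A j \<omega>"
      using sym[OF pspace[OF \<omega> p(1)]] sym[OF pspace[OF \<omega> p(2)]]
      by (simp add: A_def transpose_def vec_eq_iff)
    show "norm (A j \<omega> *v x) \<le> c * norm x" for x
      unfolding A_def by (intro bound pspace \<omega> p)
    show "A j (T j \<omega>) = - A j \<omega>"
      using p ik by (simp add: A_def T_apply \<sigma>_def)
    show "A l (T j \<omega>) = A l \<omega>" if "l \<in> {1..n}" "l \<noteq> j" for l
      using that ik by (simp add: A_def T_apply \<sigma>_def)
  qed (use c in auto)
  have "0 < real (card {1..n}) * c\<^sup>2" using n c by simp
  from F.tail_bound[OF s this] show ?thesis
    unfolding F.X_def A_def by simp
qed

lemma iid_samples_distr: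
  assumes iid: "iid_samples P D m n Z" and "1 \<le> m" "1 \<le> n"
  shows "distr P (Pi\<^sub>M ({1..m} \<times> {1..n}) (\<lambda>_. D)) (\<lambda>\<omega>. \<lambda>p\<in>{1..m} \<times> {1..n}. Z (fst p) (snd p) \<omega>)
    = Pi\<^sub>M ({1..m} \<times> {1..n}) (\<lambda>_. D)"
proof -
  interpret P: prob_space P using iid by (simp add: iid_samples_def)
  have indep: "P.indep_vars (\<lambda>_. D) (\<lambda>(i, j). Z i j) ({1..m} \<times> {1..n})"
    using iid by (simp add: iid_samples_def)
  have ne: "{1..m} \<times> {1..n} \<noteq> {}" using assms by auto
  have rv: "p \<in> {1..m} \<times> {1..n} \<Longrightarrow> (case p of (i, j) \<Rightarrow> Z i j) \<in> measurable P D" for p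
    using indep[unfolded P.indep_vars_def, THEN conjunct1, THEN bspec] .
  have "distr P (Pi\<^sub>M ({1..m} \<times> {1..n}) (\<lambda>_. D)) (\<lambda>\<omega>. \<lambda>p\<in>{1..m} \<times> {1..n}. (case p of (i, j) \<Rightarrow> Z i j) \<omega>)
    = Pi\<^sub>M ({1..m} \<times> {1..n}) (\<lambda>p. distr P D (case p of (i, j) \<Rightarrow> Z i j))"
    by (rule iffD1[OF P.indep_vars_iff_distr_eq_PiM'[OF ne rv] indep])
  also have "\<dots> = Pi\<^sub>M ({1..m} \<times> {1..n}) (\<lambda>_. D)"
    using iid by (intro PiM_cong) (auto simp: iid_samples_def)
  finally show ?thesis by (simp add: case_prod_beta)
qed

lemma iid_samples_measurable:
  assumes "iid_samples P D m n Z" "i \<in> {1..m}" "j \<in> {1..n}"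
  shows "Z i j \<in> measurable P D"
proof -
  interpret P: prob_space P using assms by (simp add: iid_samples_def)
  have "P.indep_vars (\<lambda>_. D) (\<lambda>(i, j). Z i j) ({1..m} \<times> {1..n})"
    using assms(1) by (simp add: iid_samples_def)
  from this[unfolded P.indep_vars_def, THEN conjunct1, THEN bspec, of "(i, j)"] show ?thesis
    using assms(2,3) by simp
qed

text \<open>The event depends on the samples alone, so its probability can be computed on the
  product space, where the exchange acts.\<close>

lemma iid_samples_tail_bound:
  fixes H :: "'z \<Rightarrow> real^'n^'n"
  assumes iid: "iid_samples P D m n Z" and i: "i \<in> {1..m}" and k: "k \<in> {1..m}" "i \<noteq> k" and n: "1 \<le> n"
    and meas: "H \<in> borel_measurable D"
    and sym: "\<And>z. z \<in> space D \<Longrightarrow> transpose (H z) = H z"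
    and bound: "\<And>z z' x. z \<in> space D \<Longrightarrow> z' \<in> space D \<Longrightarrow> norm ((H z - H z') *v x) \<le> c * norm x"
    and c: "0 < c" and s: "0 \<le> s"
  shows "measure P {\<omega> \<in> space P. s < spectral_norm (\<Sum>j = 1..n. H (Z i j \<omega>) - H (Z k j \<omega>))}
    \<le> 2 * real CARD('n) * exp (- (s\<^sup>2 / (2 * (real n * c\<^sup>2))))"
proof -
  interpret P: prob_space P using iid by (simp add: iid_samples_def)
  let ?I = "{1..m} \<times> {1..n}"
  let ?Q = "Pi\<^sub>M ?I (\<lambda>_. D)"
  let ?f = "\<lambda>\<omega>. \<lambda>p\<in>?I. Z (fst p) (snd p) \<omega>"
  let ?E = "{\<omega> \<in> space ?Q. s < spectral_norm (\<Sum>j = 1..n. H (\<omega> (i, j)) - H (\<omega> (k, j)))}"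
  have m: "1 \<le> m" using i by auto
  have f: "?f \<in> measurable P ?Q"
    using iid_samples_measurable[OF iid] by (intro measurable_restrict) auto
  \<comment> \<open>\<open>D\<close> is a probability measure because it is the law of a
    sample.\<close>
  have "distr P D (Z 1 1) = D" using iid m n by (auto simp: iid_samples_def)
  then have D: "prob_space D"
    using P.prob_space_distr[OF iid_samples_measurable[OF iid, of 1 1]] m n by simp
  have "(\<lambda>\<omega>. \<Sum>j = 1..n. H (\<omega> (i, j)) - H (\<omega> (k, j))) \<in> borel_measurable ?Q"
    using i k
    by (intro borel_measurable_sum borel_measurable_diff measurable_compose[OF _ meas]
        measurable_component_singleton) auto
  from borel_measurable_continuous_on[OF continuous_on_spectral_norm this]
  have E: "?E \<in> sets ?Q" by measurable
  have "measure P {\<omega> \<in> space P. s < spectral_norm (\<Sum>j = 1..n. H (Z i j \<omega>) - H (Z k j \<omega>))}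
      = measure P (?f -` ?E \<inter> space P)"
    using measurable_space[OF f] i k by (intro arg_cong[where f = "measure P"]) auto
  also have "\<dots> = measure (distr P ?Q ?f) ?E"
    by (rule measure_distr[OF f E, symmetric])
  also have "\<dots> = measure ?Q ?E"
    by (simp only: iid_samples_distr[OF iid m n])
  also have "\<dots> \<le> 2 * real CARD('n) * exp (- (s\<^sup>2 / (2 * (real n * c\<^sup>2))))"
    by (rule product_swap_tail_bound[OF D _ i k meas sym bound c n s]) auto
  finally show ?thesis .
qed

section \<open>Numerical estimates behind the constant\<close>

text \<open>The quadratic Taylor bound is taken at \<open>7/40\<close> and raised to the fourth
  power. The value \<open>7/10\<close> stays below the slack \<open>8/10\<close> that appears in
  \<open>tail_exponent_le\<close>.\<close>

lemma ln_2_le: "ln 2 \<le> (7/10 :: real)"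
proof -
  have "(2::real) \<le> (1 + 7/40 + (7/40)\<^sup>2 / 2) ^ 4" by (simp add: power2_eq_square power4_eq_xxxx)
  also have "\<dots> \<le> exp (7/40) ^ 4"
    by (intro power_mono exp_lower_Taylor_quadratic) auto
  also have "\<dots> = exp (7/10)"
    by (simp add: exp_of_nat_mult[symmetric])
  finally have "ln 2 \<le> ln (exp (7/10 :: real))" by (subst ln_le_cancel_iff) auto
  then show ?thesis by simp
qed

text \<open>The subtracted 2 is the share of the threshold given up to discretisation, and
  \<open>ln 2\<close> pays for the factor 2 of the tail bound. The room comes from squaring the
  coefficient 4, with \<open>\<kappa>\<close> bounded away from 0.\<close>

lemma tail_exponent_le:
  assumes "ln 2 \<le> \<kappa>"
  shows "0 \<le> 4 * sqrt \<kappa> - 2" "ln 2 + \<kappa> \<le> (4 * sqrt \<kappa> - 2)\<^sup>2"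
proof -
  let ?u = "sqrt \<kappa>"
  have k: "2 / 3 \<le> \<kappa>" using assms ln2_ge_two_thirds by linarith
  then have u2: "?u\<^sup>2 = \<kappa>" by simp
  have "(8/10)\<^sup>2 \<le> \<kappa>" using k by (simp add: power2_eq_square)
  then have u: "8/10 \<le> ?u" by (rule real_le_rsqrt)
  then show "0 \<le> 4 * ?u - 2" by simp
  \<comment> \<open>The product is chosen so that its constant term is \<open>32/10\<close>; the
    rest of the 4 in the expanded square is \<open>8/10\<close>, enough for
    \<open>ln 2\<close>.\<close>
  have "0 \<le> (?u - 8/10) * (15 * ?u - 4)" using u by (intro mult_nonneg_nonneg) auto
  also have "\<dots> = 15 * ?u\<^sup>2 - 16 * ?u + 32/10"
    by (simp add: power2_eq_square algebra_simps)
  finally have "0 \<le> 15 * ?u\<^sup>2 - 16 * ?u + 32/10" .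
  moreover have "(4 * ?u - 2)\<^sup>2 = 16 * ?u\<^sup>2 - 16 * ?u + 4"
    by (simp add: power2_eq_square algebra_simps)
  ultimately show "ln 2 + \<kappa> \<le> (4 * ?u - 2)\<^sup>2"
    using ln_2_le u2 by linarith
qed

text \<open>The dimension is absorbed into the second root, whose argument becomes the
  \<open>\<kappa>\<close> of the tail estimate; \<open>4 * sqrt 2\<close> is the root of 32.\<close>

lemma sqrt_threshold_eq:
  fixes L n d y :: real
  assumes "0 < L" "0 < n" "0 < d"
  shows "sqrt (32 * L\<^sup>2 * d / n) * sqrt (x + y / d) = 4 * sqrt 2 * L * sqrt (d * x + y) / sqrt n"
proof -
  have "32 * L\<^sup>2 * d / n * (x + y / d) = (4 * L)\<^sup>2 * (2 * (d * x + y)) / n"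
    using assms by (simp add: field_simps power2_eq_square)
  then have "sqrt (32 * L\<^sup>2 * d / n) * sqrt (x + y / d) = sqrt ((4 * L)\<^sup>2 * (2 * (d * x + y)) / n)"
    by (simp only: real_sqrt_mult[symmetric])
  also have "sqrt ((4 * L)\<^sup>2 * (2 * q) / n) = 4 * sqrt 2 * L * sqrt q / sqrt n" for q
    by (simp only: real_sqrt_divide real_sqrt_mult[of "(4 * L)\<^sup>2"] real_sqrt_mult[of 2] real_sqrt_abs)
      (use assms in simp)
  finally show ?thesis .
qed

text \<open>\<open>\<kappa>\<close> is the logarithm of the net size \<open>R ^ D\<close> times
  \<open>real m * real D / \<delta>\<close>, so an exponent of \<open>ln 2 + \<kappa>\<close>
  balances the union bound at exactly \<open>\<delta>\<close>.\<close>

lemma net_tail_sum_le: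
  fixes n m D :: nat and L R B \<delta> \<kappa> :: real
  assumes "1 \<le> n" "2 \<le> m" "1 \<le> D" "0 < L" "1 \<le> R" "0 \<le> B" "B \<le> R ^ D" "0 < \<delta>" "\<delta> < 1"
  defines "\<kappa> \<equiv> real D * ln R + ln (real m * real D / \<delta>)"
  defines "s \<equiv> sqrt (2 * real n) * L * (4 * sqrt \<kappa> - 2)"
  shows "0 \<le> s"
    and "B * (real m * (2 * real D * exp (- (s\<^sup>2 / (2 * (real n * L\<^sup>2)))))) \<le> \<delta>"
proof -
  \<comment> \<open>This is where \<open>m\<close> being at least 2 yields the lower bound
    \<open>ln 2\<close> for \<open>\<kappa>\<close>.\<close>
  have "2 \<le> real m * real D / \<delta>"
  proof -
    have "2 * \<delta> \<le> 2 * 1" using assms by simp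
    also have "\<dots> \<le> real m * real D" using assms by (intro mult_mono) auto
    finally show ?thesis using assms by (simp add: pos_le_divide_eq)
  qed
  then have l: "ln 2 \<le> ln (real m * real D / \<delta>)" and pos: "0 < real m * real D / \<delta>" by auto
  have \<kappa>: "ln 2 \<le> \<kappa>" unfolding \<kappa>_def using l assms by (intro add_increasing) auto
  show "0 \<le> s" unfolding s_def using tail_exponent_le(1)[OF \<kappa>] assms by simp
  have "s\<^sup>2 / (2 * (real n * L\<^sup>2)) = (4 * sqrt \<kappa> - 2)\<^sup>2"
    unfolding s_def power_mult_distrib using assms by simp
  then have "exp (- (s\<^sup>2 / (2 * (real n * L\<^sup>2)))) \<le> exp (- (ln 2 + \<kappa>))"
    using tail_exponent_le(2)[OF \<kappa>] by simp
  also have "\<dots> = inverse (2 * (R ^ D * (real m * real D / \<delta>)))"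
  proof -
    have "exp (real D * ln R) = R ^ D" using assms by (simp add: exp_of_nat_mult)
    then have "exp (ln 2 + \<kappa>) = 2 * (R ^ D * (real m * real D / \<delta>))"
      unfolding \<kappa>_def exp_add using pos by simp
    then show ?thesis by (simp only: exp_minus)
  qed
  finally have e: "exp (- (s\<^sup>2 / (2 * (real n * L\<^sup>2)))) \<le> inverse (2 * (R ^ D * (real m * real D / \<delta>)))" .
  have "B * (real m * (2 * real D * exp (- (s\<^sup>2 / (2 * (real n * L\<^sup>2))))))
      \<le> R ^ D * (real m * (2 * real D * inverse (2 * (R ^ D * (real m * real D / \<delta>)))))"
    using assms e by (intro mult_mono mult_left_mono) auto
  also have "\<dots> = \<delta>" using assms by (simp add: field_simps)
  finally show "B * (real m * (2 * real D * exp (- (s\<^sup>2 / (2 * (real n * L\<^sup>2)))))) \<le> \<delta>" .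
qed

text \<open>A net of mesh \<open>e / M\<close>, phrased without division so that
  \<open>M = 0\<close> is covered by a single point.\<close>

lemma scaled_cball_net:
  assumes M: "0 \<le> M" and r: "0 \<le> r" and e: "0 < e"
  obtains N :: "'a::euclidean_space set" where "finite N"
    "real (card N) \<le> (1 + 2 * r * M / e) ^ DIM('a)"
    "\<And>w. w \<in> cball 0 r \<Longrightarrow> \<exists>u\<in>N. M * dist w u \<le> e"
proof (cases "M = 0")
  case True
  then show ?thesis using that[of "{0}"] e by simp
next
  case False
  then have M: "0 < M" using M by simp
  obtain N :: "'a set" where N: "finite N" "real (card N) \<le> (1 + 2 * r / (e / M)) ^ DIM('a)"
    "\<And>w. w \<in> cball 0 r \<Longrightarrow> \<exists>u\<in>N. dist w u \<le> e / M"
    using cball_net[of "e / M" r] M e r by (metis divide_pos_pos)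
  show ?thesis
    by (rule that[of N]) (use N M in \<open>simp_all add: pos_le_divide_eq mult.commute\<close>)
qed

section \<open>The uniform bound\<close>

lemma uniform_matrix_deviation:
  fixes H :: "real^'n \<Rightarrow> 'z \<Rightarrow> real^'n^'n" and L M r \<delta> :: real and m n i :: nat
  assumes iid: "iid_samples P D m n Z" and i: "i \<in> {1..m}" and n: "1 \<le> n"
    and meas: "\<And>w. H w \<in> borel_measurable D"
    and sym: "\<And>w z. z \<in> space D \<Longrightarrow> transpose (H w z) = H w z"
    and bound: "\<And>w z z' x. z \<in> space D \<Longrightarrow> z' \<in> space D \<Longrightarrow> norm ((H w z - H w z') *v x) \<le> L * norm x"
    and lip: "\<And>u w z. z \<in> space D \<Longrightarrow> spectral_norm (H u z - H w z) \<le> M * norm (u - w)"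
    and L: "0 < L" and M: "0 \<le> M" and r: "0 < r" and \<delta>: "0 < \<delta>" "\<delta> < 1"
  defines "t \<equiv> sqrt (32 * L\<^sup>2 * real CARD('n) / real n) *
      sqrt (ln (1 + r * M * sqrt (2 * real n) / L) + ln (real m * real CARD('n) / \<delta>) / real CARD('n))"
  defines "\<Delta> \<equiv> \<lambda>w \<omega>. (1 / real m) *\<^sub>R (\<Sum>k = 1..m. (1 / real n) *\<^sub>R
      (\<Sum>j = 1..n. H w (Z i j \<omega>) - H w (Z k j \<omega>)))"
  shows "1 - \<delta> \<le> measure P {\<omega> \<in> space P. \<forall>w\<in>cball 0 r. spectral_norm (\<Delta> w \<omega>) \<le> min L t}"
proof -
  interpret P: prob_space P using iid by (simp add: iid_samples_def)
  let ?d = "CARD('n)"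
  define E where "E k w \<omega> = (\<Sum>j = 1..n. H w (Z i j \<omega>) - H w (Z k j \<omega>))" for k w \<omega>
  define R where "R = 1 + r * M * sqrt (2 * real n) / L"
  define \<kappa> where "\<kappa> = real ?d * ln R + ln (real m * real ?d / \<delta>)"
  define s where "s = sqrt (2 * real n) * L * (4 * sqrt \<kappa> - 2)"
  \<comment> \<open>The accuracy of the net, chosen so that \<open>2 * \<epsilon>\<close> is the
    part of \<open>t\<close> set aside by the \<open>- 2\<close> in \<open>s\<close>.\<close>
  define \<epsilon> where "\<epsilon> = sqrt 2 * L / sqrt (real n)"
  have \<Delta>: "\<Delta> w \<omega> = (1 / real (card {1..m})) *\<^sub>R (\<Sum>k\<in>{1..m}. (1 / real n) *\<^sub>R E k w \<omega>)" for w \<omega>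
    by (simp add: \<Delta>_def E_def)
  have m: "1 \<le> m" and n0: "0 < real n" and d: "1 \<le> ?d" using i n by auto
  have R: "1 \<le> R" using M r L by (simp add: R_def)
  have \<epsilon>: "0 < \<epsilon>" using L n0 by (simp add: \<epsilon>_def)
  have Zm: "Z k j \<in> measurable P D" if "k \<in> {1..m}" "j \<in> {1..n}" for k j
    using iid_samples_measurable[OF iid that] .
  have Zs: "Z k j \<omega> \<in> space D" if "\<omega> \<in> space P" "k \<in> {1..m}" "j \<in> {1..n}" for k j \<omega>
    using measurable_space[OF Zm] that by blast
  have E_meas: "(\<lambda>\<omega>. E k w \<omega>) \<in> borel_measurable P" if "k \<in> {1..m}" for k w
    unfolding E_def using that i
    by (intro borel_measurable_sum borel_measurable_diff measurable_compose[OF _ meas] Zm) auto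
  have E_bound: "spectral_norm ((1 / real n) *\<^sub>R E k w \<omega>) \<le> L"
    if "\<omega> \<in> space P" "k \<in> {1..m}" for k w \<omega>
  proof -
    have "spectral_norm ((1 / real (card {1..n})) *\<^sub>R E k w \<omega>) \<le> L"
      unfolding E_def using that i n
      by (intro spectral_norm_average_le spectral_norm_le bound Zs) auto
    then show ?thesis by simp
  qed
  have E_lip: "spectral_norm ((1 / real n) *\<^sub>R E k w \<omega> - (1 / real n) *\<^sub>R E k u \<omega>) \<le> 2 * (M * norm (w - u))"
    if "\<omega> \<in> space P" "k \<in> {1..m}" for k w u \<omega>
  proof -
    have "spectral_norm ((H w (Z i j \<omega>) - H u (Z i j \<omega>)) + - (H w (Z k j \<omega>) - H u (Z k j \<omega>)))
        \<le> 2 * (M * norm (w - u))" if j: "j \<in> {1..n}" for j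
      using lip[OF Zs[OF \<open>\<omega> \<in> space P\<close> i j], of w u]
        lip[OF Zs[OF \<open>\<omega> \<in> space P\<close> \<open>k \<in> {1..m}\<close> j], of w u]
        spectral_norm_triangle[of "H w (Z i j \<omega>) - H u (Z i j \<omega>)" "- (H w (Z k j \<omega>) - H u (Z k j \<omega>))"]
      unfolding spectral_norm_minus by linarith
    then have "spectral_norm ((1 / real (card {1..n})) *\<^sub>R (\<Sum>j\<in>{1..n}.
        (H w (Z i j \<omega>) - H u (Z i j \<omega>)) + - (H w (Z k j \<omega>) - H u (Z k j \<omega>)))) \<le> 2 * (M * norm (w - u))"
      using n by (intro spectral_norm_average_le) auto
    moreover have "(\<Sum>j\<in>{1..n}. (H w (Z i j \<omega>) - H u (Z i j \<omega>)) + - (H w (Z k j \<omega>) - H u (Z k j \<omega>)))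
        = E k w \<omega> - E k u \<omega>"
      unfolding E_def sum_subtractf[symmetric] by (intro sum.cong) auto
    ultimately show ?thesis by (simp add: scaleR_diff_right)
  qed
  have \<Delta>_cont: "continuous_on UNIV (\<lambda>w. spectral_norm (\<Delta> w \<omega>))" if \<omega>: "\<omega> \<in> space P" for \<omega>
  proof (rule lipschitz_on_continuous_on)
    show "(2 * M)-lipschitz_on UNIV (\<lambda>w. spectral_norm (\<Delta> w \<omega>))"
    proof (rule lipschitz_onI)
      fix w u
      have "\<bar>spectral_norm (\<Delta> w \<omega>) - spectral_norm (\<Delta> u \<omega>)\<bar> \<le> spectral_norm (\<Delta> w \<omega> - \<Delta> u \<omega>)"
        by (rule spectral_norm_diff_le)
      also have "\<Delta> w \<omega> - \<Delta> u \<omega> = (1 / real (card {1..m})) *\<^sub>R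
          (\<Sum>k\<in>{1..m}. (1 / real n) *\<^sub>R E k w \<omega> - (1 / real n) *\<^sub>R E k u \<omega>)"
        by (simp only: \<Delta> scaleR_diff_right sum_subtractf)
      also have "spectral_norm \<dots> \<le> 2 * (M * norm (w - u))"
        using m by (intro spectral_norm_average_le E_lip \<omega>) auto
      finally show "dist (spectral_norm (\<Delta> w \<omega>)) (spectral_norm (\<Delta> u \<omega>)) \<le> 2 * M * dist w u"
        by (simp add: dist_norm mult.assoc)
    qed (use M in simp)
  qed
  have \<Delta>_meas: "(\<lambda>\<omega>. spectral_norm (\<Delta> w \<omega>)) \<in> borel_measurable P" for w
    unfolding \<Delta>
    by (intro borel_measurable_continuous_on[OF continuous_on_spectral_norm]
        borel_measurable_scaleR borel_measurable_sum measurable_const E_meas) auto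
  let ?G = "{\<omega> \<in> space P. \<forall>w\<in>cball 0 r. spectral_norm (\<Delta> w \<omega>) \<le> min L t}"
  have G_meas: "?G \<in> sets P"
  proof -
    \<comment> \<open>Continuity in \<open>w\<close> reduces the quantifier over the ball to a
      countable dense subset, which makes the event measurable.\<close>
    obtain T where T: "countable T" "T \<subseteq> cball (0 :: real^'n) r" "cball 0 r \<subseteq> closure T"
      using separable by blast
    have "?G = {\<omega> \<in> space P. \<forall>w\<in>T. spectral_norm (\<Delta> w \<omega>) \<le> min L t}"
    proof (intro Collect_cong conj_cong refl iffI ballI)
      fix \<omega> w assume \<omega>: "\<omega> \<in> space P" and le: "\<forall>w\<in>T. spectral_norm (\<Delta> w \<omega>) \<le> min L t"
        and w: "w \<in> cball (0 :: real^'n) r"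
      have "closed {w. spectral_norm (\<Delta> w \<omega>) \<le> min L t}"
        by (intro closed_Collect_le \<Delta>_cont \<omega> continuous_on_const)
      then have "closure T \<subseteq> {w. spectral_norm (\<Delta> w \<omega>) \<le> min L t}"
        using le by (intro closure_minimal) auto
      then show "spectral_norm (\<Delta> w \<omega>) \<le> min L t" using T(3) w by blast
    qed (use T(2) in blast)
    also have "\<dots> \<in> sets P"
    proof -
      have [measurable]: "(\<lambda>\<omega>. spectral_norm (\<Delta> w \<omega>)) \<in> borel_measurable P" for w by (rule \<Delta>_meas)
      have "T \<noteq> {}" using T(3) r by auto
      then have eq: "{\<omega> \<in> space P. \<forall>w\<in>T. spectral_norm (\<Delta> w \<omega>) \<le> min L t}
          = {\<omega> \<in> space P. \<forall>k. spectral_norm (\<Delta> (from_nat_into T k) \<omega>) \<le> min L t}"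
        using range_from_nat_into[OF _ T(1)] by (metis (lifting) image_iff rangeI)
      show ?thesis unfolding eq by measurable
    qed
    finally show ?thesis .
  qed
  have t_eq: "t = 4 * sqrt 2 * L * sqrt \<kappa> / sqrt (real n)"
    unfolding t_def \<kappa>_def R_def using L n0 by (intro sqrt_threshold_eq) auto
  have t_eq_s: "t = s / real n + 2 * \<epsilon>"
  proof -
    define q where "q = sqrt (real n)"
    have q: "0 < q" "real n = q * q" using n0 by (auto simp: q_def)
    have "s / real n = sqrt 2 * L * (4 * sqrt \<kappa> - 2) / q"
      unfolding s_def real_sqrt_mult[of 2 "real n"] q_def[symmetric] using q by simp
    then show ?thesis
      using q unfolding t_eq \<epsilon>_def q_def[symmetric] by (simp add: field_simps)
  qed
  have "1 \<le> real m * real ?d / \<delta>"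
    using \<delta> m d mult_mono[of 1 "real m" 1 "real ?d"] by (simp add: pos_le_divide_eq)
  then have "0 \<le> \<kappa>" unfolding \<kappa>_def using R by simp
  \<comment> \<open>Nonnegativity of \<open>t\<close> covers the zero matrix that occurs at
    \<open>k = i\<close>.\<close>
  then have t0: "0 \<le> t" unfolding t_eq using L by simp
  obtain N :: "(real^'n) set" where N: "finite N" "real (card N) \<le> (1 + 2 * r * M / \<epsilon>) ^ DIM(real^'n)"
    "\<And>w. w \<in> cball 0 r \<Longrightarrow> \<exists>u\<in>N. M * dist w u \<le> \<epsilon>"
    using scaled_cball_net[OF M less_imp_le[OF r] \<epsilon>] by metis
  \<comment> \<open>This choice of \<open>\<epsilon>\<close> makes the net size match the argument
    of the logarithm in the threshold.\<close>
  have "1 + 2 * r * M / \<epsilon> = R"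
  proof -
    have "2 / sqrt 2 = sqrt 2" by (rule real_div_sqrt) simp
    then have "r * M * sqrt (real n) / L * (2 / sqrt 2) = r * M * sqrt (real n) / L * sqrt 2"
      by (simp only:)
    then show ?thesis
      using L n0 by (simp add: R_def \<epsilon>_def real_sqrt_mult mult_ac)
  qed
  then have cardN: "real (card N) \<le> R ^ ?d" using N(2) by simp
  define K where "K = N \<times> ({1..m} - {i})"
  define F where "F p = {\<omega> \<in> space P. s < spectral_norm (E (snd p) (fst p) \<omega>)}" for p
  have finK: "finite K" using N(1) by (simp add: K_def)
  have F_meas: "F p \<in> sets P" if "p \<in> K" for p
  proof -
    have "(\<lambda>\<omega>. spectral_norm (E (snd p) (fst p) \<omega>)) \<in> borel_measurable P"
      using that by (intro borel_measurable_continuous_on[OF continuous_on_spectral_norm] E_meas)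
        (auto simp: K_def)
    then show ?thesis unfolding F_def by measurable
  qed
  have bad: "measure P (\<Union>p\<in>K. F p) \<le> \<delta>"
  \<comment> \<open>With a single group there is no index other than \<open>i\<close> and no bad
    event, while the numerical estimate asks for \<open>m\<close> at least 2.\<close>
  proof (cases "m = 1")
    case True
    then have "K = {}" using i by (auto simp: K_def)
    then show ?thesis using \<delta> by simp
  next
    case False
    then have m2: "2 \<le> m" using m by simp
    note num = net_tail_sum_le[OF n m2 d L R _ cardN \<delta>, folded \<kappa>_def, folded s_def]
    let ?e = "2 * real ?d * exp (- (s\<^sup>2 / (2 * (real n * L\<^sup>2))))"
    have "measure P (\<Union>p\<in>K. F p) \<le> (\<Sum>p\<in>K. measure P (F p))"
      using F_meas by (intro measure_UNION_le finK) auto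
    also have "\<dots> \<le> (\<Sum>p\<in>K. ?e)"
    proof (rule sum_mono)
      fix p assume "p \<in> K"
      then show "measure P (F p) \<le> ?e"
        unfolding F_def E_def K_def
        by (intro iid_samples_tail_bound[OF iid i _ _ n meas sym bound L num(1)]) auto
    qed
    also have "\<dots> = real (card N) * (real (card ({1..m} - {i})) * ?e)"
      by (simp add: K_def card_cartesian_product)
    also have "\<dots> \<le> real (card N) * (real m * ?e)"
      by (intro mult_left_mono mult_right_mono) (auto intro: order_trans[OF card_mono[of "{1..m}"]])
    also have "\<dots> \<le> \<delta>" using num(2) by simp
    finally show ?thesis .
  qed
  have good: "space P - (\<Union>p\<in>K. F p) \<subseteq> ?G"
  proof (intro subsetI CollectI conjI ballI)
    fix \<omega> assume \<omega>': "\<omega> \<in> space P - (\<Union>p\<in>K. F p)"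
    then show \<omega>: "\<omega> \<in> space P" by simp
    fix w assume "w \<in> cball (0 :: real^'n) r"
    then obtain u where u: "u \<in> N" "M * norm (w - u) \<le> \<epsilon>"
      using N(3) by (auto simp: dist_norm)
    have "spectral_norm ((1 / real n) *\<^sub>R E k w \<omega>) \<le> t" if k: "k \<in> {1..m}" for k
    proof (cases "k = i")
      case True
      then show ?thesis using t0 by (simp add: E_def)
    next
      case False
      then have "(u, k) \<in> K" using u k by (simp add: K_def)
      then have "spectral_norm (E k u \<omega>) \<le> s" using \<omega>' by (force simp: F_def)
      then have "spectral_norm ((1 / real n) *\<^sub>R E k u \<omega>) \<le> s / real n"
        using n0 by (simp add: spectral_norm_scaleR divide_right_mono)
      then show ?thesis
        using E_lip[OF \<omega> k, of w u] u(2) t_eq_s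
          spectral_norm_diff_le[of "(1 / real n) *\<^sub>R E k w \<omega>" "(1 / real n) *\<^sub>R E k u \<omega>"] by linarith
    qed
    then have "spectral_norm (\<Delta> w \<omega>) \<le> t"
      unfolding \<Delta> using m by (intro spectral_norm_average_le) auto
    \<comment> \<open>The bound by \<open>L\<close> holds at every sample point; only the bound by
      \<open>t\<close> relies on the good event.\<close>
    moreover have "spectral_norm (\<Delta> w \<omega>) \<le> L"
      unfolding \<Delta> using m E_bound[OF \<omega>] by (intro spectral_norm_average_le) auto
    ultimately show "spectral_norm (\<Delta> w \<omega>) \<le> min L t" by simp
  qed
  have U: "(\<Union>p\<in>K. F p) \<in> sets P" using F_meas finK by (intro sets.finite_UN) auto
  have "1 - \<delta> \<le> 1 - measure P (\<Union>p\<in>K. F p)" using bad by simp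
  also have "\<dots> = measure P (space P - (\<Union>p\<in>K. F p))" by (rule P.prob_compl[OF U, symmetric])
  also have "\<dots> \<le> measure P ?G" by (rule P.finite_measure_mono[OF good G_meas])
  finally show ?thesis .
qed

theorem lemma6:
  fixes P :: "'a measure"
    and D :: "'z measure"
    and Z :: "nat \<Rightarrow> nat \<Rightarrow> 'a \<Rightarrow> 'z"
    and \<phi> :: "real ^ 'd \<Rightarrow> 'z \<Rightarrow> real"
    and m n i :: nat
    and lam V0 G L M \<delta> r d :: real
  assumes "m \<ge> 1" and "n \<ge> 1"
    and "iid_samples P D m n Z"
    and "\<And>w. (\<lambda>z. \<phi> w z) \<in> borel_measurable D"
    and "lam > 0"
    and "\<And>z. z \<in> space D \<Longrightarrow> convex_on UNIV (\<lambda>w. \<phi> w z)"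
    and "\<And>z. z \<in> space D \<Longrightarrow> twice_differentiable (\<lambda>w. \<phi> w z)"
    and "\<And>z w. z \<in> space D \<Longrightarrow> \<phi> w z \<ge> 0"
    and "\<And>z. z \<in> space D \<Longrightarrow> \<phi> 0 z \<le> V0"
    and "\<And>z w. z \<in> space D \<Longrightarrow> norm w \<le> sqrt (2 * V0 / lam) \<Longrightarrow>
           norm (gradient (\<lambda>w. \<phi> w z) w) \<le> G"
    and "\<And>z w. z \<in> space D \<Longrightarrow>
           spectral_norm (hessian (\<lambda>w. \<phi> w z) w) \<le> L - lam"
    and "\<And>z u w. z \<in> space D \<Longrightarrow>
           spectral_norm (hessian (\<lambda>w. \<phi> w z) u - hessian (\<lambda>w. \<phi> w z) w)
             \<le> M * norm (u - w)"
    and "0 < \<delta>" and "\<delta> < 1" and "r > 0" and "i \<in> {1..m}"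
    and "d = real CARD('d)"
  shows "measure P {\<omega> \<in> space P.
           (SUP w \<in> {w :: real ^ 'd. norm w \<le> r}.
              ereal (spectral_norm
                (hessian (local_loss \<phi> lam n (\<lambda>j. Z i j \<omega>)) w
                 - hessian (global_loss \<phi> lam m n (\<lambda>i j. Z i j \<omega>)) w)))
           \<le> ereal (min L
                (sqrt (32 * L\<^sup>2 * d / real n) *
                 sqrt (ln (1 + r * M * sqrt (2 * real n) / L)
                       + ln (real m * d / \<delta>) / d)))}
         \<ge> 1 - \<delta>"
proof -
  interpret P: prob_space P using assms(3) by (simp add: iid_samples_def)
  let ?H = "\<lambda>w z. hessian (\<lambda>w. \<phi> w z) w"
  have Zs: "Z k j \<omega> \<in> space D" if "\<omega> \<in> space P" "k \<in> {1..m}" "j \<in> {1..n}" for k j \<omega>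
    using measurable_space[OF iid_samples_measurable[OF assms(3)]] that by blast
  \<comment> \<open>A single sample point suffices to read off the signs of \<open>L\<close> and
    \<open>M\<close> from the bounds on the Hessians.\<close>
  obtain \<omega>0 where "\<omega>0 \<in> space P" using P.not_empty by blast
  then have z0: "Z 1 1 \<omega>0 \<in> space D" using assms(1,2) by (intro Zs) auto
  have L: "0 < L"
    using spectral_norm_nonneg[of "?H 0 (Z 1 1 \<omega>0)"] assms(11)[OF z0, of 0] assms(5) by linarith
  have M: "0 \<le> M"
    using order_trans[OF spectral_norm_nonneg assms(12)[OF z0, of "axis undefined 1" 0]] by simp
  note gh = twice_differentiable_has_gradient_hessian[OF assms(7)]
  have sym: "transpose (?H w z) = ?H w z" if "z \<in> space D" for w z
    using transpose_hessian[OF gh[OF that]] .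
  have bound: "norm ((?H w z - ?H w z') *v x) \<le> L * norm x"
    if "z \<in> space D" "z' \<in> space D" for w z z' x
  proof -
    \<comment> \<open>Convexity enters here, through positive semidefinite Hessians; the bound is
      then relaxed from \<open>L - lam\<close> to the \<open>L\<close> of the threshold.\<close>
    have "norm ((?H w z - ?H w z') *v x) \<le> (L - lam) * norm x"
      using that by (intro norm_diff_psd_le sym assms(11) hessian_psd[OF assms(6) gh])
    also have "\<dots> \<le> L * norm x" using assms(5) by (intro mult_right_mono) auto
    finally show ?thesis .
  qed
  have diff: "hessian (local_loss \<phi> lam n (\<lambda>j. Z i j \<omega>)) w
      - hessian (global_loss \<phi> lam m n (\<lambda>i j. Z i j \<omega>)) w
      = (1 / real m) *\<^sub>R (\<Sum>k = 1..m. (1 / real n) *\<^sub>R (\<Sum>j = 1..n. ?H w (Z i j \<omega>) - ?H w (Z k j \<omega>)))"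
    if "\<omega> \<in> space P" for \<omega> w
    by (rule hessian_local_minus_global[where zs = "\<lambda>i j. Z i j \<omega>"])
      (use that assms(7,16) Zs in blast)+
  \<comment> \<open>In the complete lattice \<open>ereal\<close> a supremum is at most
    \<open>c\<close> exactly when every term is, so no boundedness has to be shown first.\<close>
  have event: "{\<omega> \<in> space P. (SUP w \<in> {w. norm w \<le> r}. ereal (spectral_norm
        (hessian (local_loss \<phi> lam n (\<lambda>j. Z i j \<omega>)) w
          - hessian (global_loss \<phi> lam m n (\<lambda>i j. Z i j \<omega>)) w))) \<le> ereal c}
      = {\<omega> \<in> space P. \<forall>w\<in>cball 0 r. spectral_norm ((1 / real m) *\<^sub>R (\<Sum>k = 1..m.
          (1 / real n) *\<^sub>R (\<Sum>j = 1..n. ?H w (Z i j \<omega>) - ?H w (Z k j \<omega>)))) \<le> c}" for c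
    by (intro Collect_cong conj_cong refl) (simp add: diff SUP_le_iff Ball_def)
  show ?thesis
    unfolding event assms(17)
    by (rule uniform_matrix_deviation[OF assms(3,16,2) borel_measurable_hessian[OF assms(4,7)]
          sym bound assms(12) L M assms(15,13,14)])
qed

end
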